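(* Let $L>0$ and $m>1$. Let $a\in L^\infty(0,L)$ be such that there exist constants $0<\alpha<\beta$ with $\alpha\le a(x)\le\beta$ for a.e. $x\in(0,L)$, and let $g\in L^m(0,L)$. Let $\phi:\mathbb{R}\to\mathbb{R}\cup\{+\infty\}$ be continuous with values in $\mathbb{R}\cup\{+\infty\}$, with $\phi(s)<+\infty$ for every $s\neq 0$ and $\phi(0)=+\infty$. Assume that for every $\delta>0$ $$\int_0^\delta|\phi(t)|^{m-1}\,dt=+\infty\quad\text{and}\quad\int_{-\delta}^0|\phi(t)|^{m-1}\,dt=+\infty .$$ Then there does not exist any weak solution, in the sense of Definition $m$, of the problem $$-\frac{d}{dx}\left(a(x)\frac{du}{dx}\right)=-\frac{d\phi(u)}{dx}-\frac{dg(x)}{dx}\ \text{ in }(0,L),\qquad u(0)=u(L)=0 .$$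
   Context: $\mathbb{R}\cup\{+\infty\}$ carries its usual topology (neighbourhoods of $+\infty$ contain some $(M,+\infty]$). Elements of $W^{1,1}_0(0,L)$ are identified with their continuous representatives on $[0,L]$, and $\phi(u)$ denotes the function $x\mapsto\phi(u(x))$. Weak solution in the sense of Definition $m$ (for $m>1$): a function $u$ such that $u\in W^{1,m}_0(0,L)$, $\phi(u)\in L^m(0,L)$, and $$\int_0^L a(x)\frac{du}{dx}\frac{dz}{dx}\,dx=\int_0^L\phi(u)\frac{dz}{dx}\,dx+\int_0^L g(x)\frac{dz}{dx}\,dx\qquad\forall z\in W^{1,m'}_0(0,L),$$ where $m'=\frac{m}{m-1}$. *)

theory Defs
  imports "HOL-Analysis.Analysis"
begin

definition Lp :: "real \<Rightarrow> real \<Rightarrow> (real \<Rightarrow> real) set" where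
  "Lp L p = {f. f \<in> borel_measurable (lebesgue_on {0<..<L}) \<and>
                integrable (lebesgue_on {0<..<L}) (\<lambda>x. \<bar>f x\<bar> powr p)}"

definition Lp_norm :: "real \<Rightarrow> real \<Rightarrow> (real \<Rightarrow> real) \<Rightarrow> real" where
  "Lp_norm L p f = (LINT x|lebesgue_on {0<..<L}. \<bar>f x\<bar> powr p) powr (1 / p)"

definition Linf :: "real \<Rightarrow> (real \<Rightarrow> real) set" where
  "Linf L = {f. f \<in> borel_measurable (lebesgue_on {0<..<L}) \<and>
                (\<exists>C. AE x in lebesgue_on {0<..<L}. \<bar>f x\<bar> \<le> C)}"

text \<open>\<^const>\<open>real_of_ereal\<close> sends infinite values to 0, so finiteness almost everywhere has to be
  required separately.\<close>

definition Lp_ereal :: "real \<Rightarrow> real \<Rightarrow> (real \<Rightarrow> ereal) set" where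
  "Lp_ereal L p = {f. (AE x in lebesgue_on {0<..<L}. \<bar>f x\<bar> \<noteq> \<infinity>) \<and>
                      (\<lambda>x. real_of_ereal (f x)) \<in> Lp L p}"

text \<open>$C_c^\infty(0,L)$, each function being extended by 0 to the whole line.\<close>

definition test_functions :: "real \<Rightarrow> (real \<Rightarrow> real) set" where
  "test_functions L = {\<psi>. (\<forall>k x. (deriv ^^ k) \<psi> field_differentiable at x) \<and>
                          (\<exists>K. compact K \<and> K \<subseteq> {0<..<L} \<and> (\<forall>x. x \<notin> K \<longrightarrow> \<psi> x = 0))}"

text \<open>\<open>u\<close> belongs to $W^{1,p}(0,L)$ and \<open>v\<close> is (a representative of) its weak derivative, which is
  unique up to null sets.\<close>

definition W1p :: "real \<Rightarrow> real \<Rightarrow> (real \<Rightarrow> real) \<Rightarrow> (real \<Rightarrow> real) \<Rightarrow> bool" where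
  "W1p L p u v \<longleftrightarrow> u \<in> Lp L p \<and> v \<in> Lp L p \<and>
     (\<forall>\<psi> \<in> test_functions L.
        (LINT x|lebesgue_on {0<..<L}. u x * deriv \<psi> x) =
        - (LINT x|lebesgue_on {0<..<L}. v x * \<psi> x))"

text \<open>$W^{1,p}_0(0,L)$ is the closure of $C_c^\infty(0,L)$ in $W^{1,p}(0,L)$; each element is taken
  to be its continuous representative on $[0,L]$. Values outside $[0,L]$ are irrelevant.\<close>

definition W1p0 :: "real \<Rightarrow> real \<Rightarrow> (real \<Rightarrow> real) set" where
  "W1p0 L p = {u. continuous_on {0..L} u \<and>
     (\<exists>v. W1p L p u v \<and>
        (\<forall>\<epsilon>>0. \<exists>\<psi> \<in> test_functions L.
           Lp_norm L p (\<lambda>x. u x - \<psi> x) + Lp_norm L p (\<lambda>x. v x - deriv \<psi> x) < \<epsilon>))}"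

definition weak_solution ::
  "real \<Rightarrow> real \<Rightarrow> (real \<Rightarrow> real) \<Rightarrow> (real \<Rightarrow> real) \<Rightarrow> (real \<Rightarrow> ereal) \<Rightarrow> (real \<Rightarrow> real) \<Rightarrow> bool" where
  "weak_solution L m a g \<phi> u \<longleftrightarrow>
     u \<in> W1p0 L m \<and> (\<lambda>x. \<phi> (u x)) \<in> Lp_ereal L m \<and>
     (\<exists>Du. W1p L m u Du \<and>
       (\<forall>z \<in> W1p0 L (m / (m - 1)). \<forall>Dz. W1p L (m / (m - 1)) z Dz \<longrightarrow>
         (LINT x|lebesgue_on {0<..<L}. a x * Du x * Dz x) =
         (LINT x|lebesgue_on {0<..<L}. real_of_ereal (\<phi> (u x)) * Dz x) +
         (LINT x|lebesgue_on {0<..<L}. g x * Dz x)))"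

end

theory Submission
  imports Defs "HOL-Real_Asymp.Real_Asymp"
begin

text \<open>Testing the equation with \<open>C\<^sub>c\<^sup>\<infinity>\<close> functions gives \<open>a u' = \<phi>(u) + g + c\<close> almost everywhere
  for a constant \<open>c\<close>. Since \<open>\<phi>(u)\<close> is finite almost everywhere while \<open>\<phi>(0) = \<infinity>\<close>, the continuous
  function \<open>u\<close> is nonzero somewhere, and since \<open>u(0) = 0\<close> there is a last zero before such a point.
  To the right of this zero \<open>|\<phi>(u)|\<^sup>m\<^sup>-\<^sup>1 |u'| \<le> |\<phi>(u)|\<^sup>m\<^sup>-\<^sup>1 (|\<phi>(u)| + |g| + |c|) / \<alpha>\<close> is integrable, because
  \<open>\<phi>(u)\<close> and \<open>g\<close> are in \<open>L\<^sup>m\<close>; substituting \<open>t = u(x)\<close> shows that \<open>|\<phi>|\<^sup>m\<^sup>-\<^sup>1\<close> is integrable on one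
  side of 0, a contradiction.\<close>

subsection \<open>Smooth bump functions\<close>

text \<open>The exponent m-1 is dictated by homogeneity: after the flux identity replaces u', the
  product |phi(u)|^(m-1) |u'| has degree m in phi(u), which is exactly what phi(u) in L^m controls.
  The obstacle is the zero itself: phi(u) is not continuous there, and u may oscillate on its way
  out of it. Hence the substitution is carried out on compact intervals to the right of the zero,
  only as an inequality, and with a bound that does not depend on the interval; the limit is taken
  in the t variable. Two facts have to be prepared for this. Passing from the weak equation to the
  flux identity needs enough concrete elements of C_c^infinity, which are built from e^(-1/x). And u
  has to be the indefinite integral of the very derivative occurring in the equation, which follows
  from approximation by test functions. A negative value of u is handled by reflecting both u and
  phi.\<close>

definition flat :: "nat \<Rightarrow> real \<Rightarrow> real" where
  "flat k x = (if x > 0 then (1 / x) ^ k * exp (- 1 / x) else 0)"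

text \<open>The index \<open>k\<close> is carried along because differentiating x^(-k) e^(-1/x) only
  produces higher powers of 1/x, so the family stays closed up to linear combinations. At 0 the
  right difference quotient vanishes in the limit since e^(-1/x) beats every power of 1/x.\<close>

lemma has_real_derivative_flat:
  "(flat k has_real_derivative flat (k + 2) x - real k * flat (k + 1) x) (at x)"
proof -
  consider "x > 0" | "x < 0" | "x = 0" by linarith
  then show ?thesis
  proof cases
    case 1
    have "((\<lambda>x. (1 / x) ^ k * exp (- 1 / x)) has_real_derivative
           flat (k + 2) x - real k * flat (k + 1) x) (at x)"
      using 1
      apply (auto intro!: derivative_eq_intros simp: flat_def)
      apply (cases k; simp add: field_simps power2_eq_square)
      done
    then show ?thesis
      by (rule has_field_derivative_transform_within_open[where S = "{0<..}"])
         (use 1 in \<open>auto simp: flat_def\<close>)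
  next
    case 2
    have "((\<lambda>x. 0) has_real_derivative flat (k + 2) x - real k * flat (k + 1) x) (at x)"
      using 2 by (auto simp: flat_def)
    then show ?thesis
      by (rule has_field_derivative_transform_within_open[where S = "{..<0}"])
         (use 2 in \<open>auto simp: flat_def\<close>)
  next
    case 3
    have "((\<lambda>h. flat k h / h) \<longlongrightarrow> 0) (at_right 0)"
    proof (rule Lim_transform_eventually)
      show "((\<lambda>h::real. (1 / h) ^ k * exp (- 1 / h) / h) \<longlongrightarrow> 0) (at_right 0)"
        by real_asymp
      show "\<forall>\<^sub>F h in at_right 0. (1 / h) ^ k * exp (- 1 / h) / h = flat k h / h"
        by (auto simp: flat_def eventually_at_filter)
    qed
    moreover have "((\<lambda>h. flat k h / h) \<longlongrightarrow> 0) (at_left 0)"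
      by (rule Lim_transform_eventually[of "\<lambda>_. 0"]) (auto simp: flat_def eventually_at_filter)
    ultimately have "((\<lambda>h. flat k h / h) \<longlongrightarrow> 0) (at 0)"
      by (simp add: filterlim_split_at)
    then show ?thesis
      using 3 by (simp add: DERIV_def flat_def)
  qed
qed

lemma flat_0_bounds: "0 \<le> flat 0 x" "flat 0 x < 1" "flat 0 x > 0 \<longleftrightarrow> x > 0"
  by (auto simp: flat_def)

text \<open>An algebra closed under differentiation, so all of its members are smooth.\<close>

inductive flat_algebra :: "(real \<Rightarrow> real) \<Rightarrow> bool" where
  const: "flat_algebra (\<lambda>_. c)"
| flat: "flat_algebra (\<lambda>x. flat k (p * x + q))"
| add: "flat_algebra f \<Longrightarrow> flat_algebra g \<Longrightarrow> flat_algebra (\<lambda>x. f x + g x)"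
| mult: "flat_algebra f \<Longrightarrow> flat_algebra g \<Longrightarrow> flat_algebra (\<lambda>x. f x * g x)"

lemma flat_algebra_power: "flat_algebra f \<Longrightarrow> flat_algebra (\<lambda>x. f x ^ n)"
  by (induction n) (auto intro: flat_algebra.intros)

lemma flat_algebra_diff:
  assumes "flat_algebra f" "flat_algebra g"
  shows "flat_algebra (\<lambda>x. f x - g x)"
  using flat_algebra.add[OF assms(1) flat_algebra.mult[OF flat_algebra.const[of "-1"] assms(2)]]
  by simp

lemma flat_algebra_has_derivative:
  assumes "flat_algebra f"
  shows "\<exists>f'. flat_algebra f' \<and> (\<forall>x. (f has_real_derivative f' x) (at x))"
  using assms
proof induction
  case (const c)
  then show ?case by (auto intro!: exI[of _ "\<lambda>_. 0"] flat_algebra.const)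
next
  case (flat k p q)
  let ?f' = "\<lambda>x. (flat (k + 2) (p * x + q) - real k * flat (k + 1) (p * x + q)) * p"
  have "flat_algebra ?f'"
    by (intro flat_algebra_diff flat_algebra.intros)
  moreover have "((\<lambda>x. flat k (p * x + q)) has_real_derivative ?f' x) (at x)" for x
    by (rule DERIV_chain2[OF has_real_derivative_flat]) (auto intro!: derivative_eq_intros)
  ultimately show ?case by blast
next
  case (add f g)
  then obtain f' g' where "flat_algebra f'" "\<And>x. (f has_real_derivative f' x) (at x)"
    "flat_algebra g'" "\<And>x. (g has_real_derivative g' x) (at x)" by blast
  then show ?case
    by (intro exI[of _ "\<lambda>x. f' x + g' x"]) (auto intro!: derivative_eq_intros flat_algebra.add)
next
  case (mult f g)
  then obtain f' g' where *: "flat_algebra f'" "\<And>x. (f has_real_derivative f' x) (at x)"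
    "flat_algebra g'" "\<And>x. (g has_real_derivative g' x) (at x)" by blast
  then show ?case
    using mult.hyps
    by (intro exI[of _ "\<lambda>x. f' x * g x + g' x * f x"] conjI allI DERIV_mult flat_algebra.intros) auto
qed

lemma flat_algebra_deriv_iterate:
  assumes "flat_algebra f"
  shows "flat_algebra ((deriv ^^ k) f)"
proof (induction k)
  case (Suc k)
  then obtain f' where f': "flat_algebra f'" "\<And>x. ((deriv ^^ k) f has_real_derivative f' x) (at x)"
    using flat_algebra_has_derivative by blast
  then have "(deriv ^^ Suc k) f = f'"
    by (auto simp: DERIV_imp_deriv)
  then show ?case using f' by simp
qed (use assms in simp)

lemma flat_algebra_smooth:
  assumes "flat_algebra f"
  shows "(deriv ^^ k) f field_differentiable at x"
  using flat_algebra_has_derivative[OF flat_algebra_deriv_iterate[OF assms, of k]]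
  unfolding field_differentiable_def by blast

text \<open>The product b of the two flat factors lies in [0,1) and is positive exactly on (s,t), so
  1 - (1-b)^n increases to the indicator of (s,t) while its support stays in [s,t]. Being polynomial
  in b, it is smooth for every \<open>n\<close>.\<close>

definition bump :: "real \<Rightarrow> real \<Rightarrow> nat \<Rightarrow> real \<Rightarrow> real" where
  "bump s t n x = 1 - (1 - flat 0 (x - s) * flat 0 (t - x)) ^ n"

lemma bump_bounds:
  "0 \<le> bump s t n x" "bump s t n x \<le> 1" "x \<notin> {s<..<t} \<Longrightarrow> bump s t n x = 0"
  "x \<in> {s<..<t} \<Longrightarrow> n > 0 \<Longrightarrow> bump s t n x > 0"
proof -
  let ?b = "flat 0 (x - s) * flat 0 (t - x)"
  have b: "0 \<le> ?b" "?b < 1"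
    using flat_0_bounds[of "x - s"] flat_0_bounds[of "t - x"]
    by (auto intro: mult_less_le_imp_less[of _ 1 _ 1, simplified] mult_strict_mono[of _ 1 _ 1, simplified])
       (metis less_eq_real_def mult_le_one mult_less_cancel_left1 order_less_le_trans linorder_not_less)
  show "0 \<le> bump s t n x" "bump s t n x \<le> 1"
    using b by (auto simp: bump_def power_le_one)
  show "x \<notin> {s<..<t} \<Longrightarrow> bump s t n x = 0"
    by (auto simp: bump_def flat_def)
  show "bump s t n x > 0" if "x \<in> {s<..<t}" "n > 0"
  proof -
    have "?b > 0" using that flat_0_bounds(3) by auto
    then have "(1 - ?b) ^ n < 1" using b that by (intro power_less_one_iff[THEN iffD2]) auto
    then show ?thesis by (simp add: bump_def)
  qed
qed

lemma bump_tendsto_indicator: "(\<lambda>n. bump s t n x) \<longlonglongrightarrow> indicator {s<..<t} x"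
proof (cases "x \<in> {s<..<t}")
  case True
  let ?b = "flat 0 (x - s) * flat 0 (t - x)"
  have "?b > 0" "\<bar>1 - ?b\<bar> < 1"
    using True flat_0_bounds[of "x - s"] flat_0_bounds[of "t - x"] bump_bounds(4)[of x s t 1]
    by (auto simp: bump_def abs_if intro!: mult_pos_pos) (metis less_eq_real_def mult_le_one not_less zero_less_mult_iff)
  then have "(\<lambda>n. 1 - (1 - ?b) ^ n) \<longlonglongrightarrow> 1 - 0"
    by (intro tendsto_intros LIMSEQ_abs_realpow_zero2)
  then show ?thesis using True by (simp add: bump_def)
qed (simp add: bump_bounds)

lemma bump_test_function:
  assumes "0 < s" "t < L"
  shows "bump s t n \<in> test_functions L"
proof -
  \<comment> \<open>The arguments are spelled as p * x + q so that the introduction rule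
    \<open>flat\<close> matches.\<close>
  have "flat_algebra (\<lambda>x. 1 - (1 - flat 0 (1 * x + (- s)) * flat 0 ((-1) * x + t)) ^ n)"
    by (intro flat_algebra_diff flat_algebra_power flat_algebra.intros)
  then have "flat_algebra (bump s t n)"
    by (simp add: bump_def[abs_def])
  then show ?thesis
    using assms
    by (auto simp: test_functions_def flat_algebra_smooth bump_bounds
             intro!: exI[of _ "{s..t}"])
qed

section \<open>Stability of test functions under derivatives, combinations and mean-zero
  antiderivatives\<close>

lemma test_function_has_derivative:
  assumes "\<psi> \<in> test_functions L"
  shows "(\<psi> has_real_derivative deriv \<psi> x) (at x)"
proof -
  have "(deriv ^^ 0) \<psi> field_differentiable at x"
    using assms unfolding test_functions_def by blast
  then show ?thesis
    by (simp add: field_differentiable_derivI)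
qed

lemma test_function_continuous:
  assumes "\<psi> \<in> test_functions L"
  shows "continuous_on A \<psi>"
  using test_function_has_derivative[OF assms] DERIV_isCont continuous_at_imp_continuous_on by blast

lemma test_function_outside:
  assumes "\<psi> \<in> test_functions L" "x \<le> 0 \<or> L \<le> x"
  shows "\<psi> x = 0"
  using assms by (fastforce simp: test_functions_def)

lemma test_function_deriv:
  assumes "\<psi> \<in> test_functions L"
  shows "deriv \<psi> \<in> test_functions L"
proof -
  obtain K where K: "compact K" "K \<subseteq> {0<..<L}" "\<And>x. x \<notin> K \<Longrightarrow> \<psi> x = 0"
    using assms by (auto simp: test_functions_def)
  have "deriv \<psi> x = 0" if "x \<notin> K" for x
  proof -
    have "((\<lambda>_. 0) has_real_derivative 0) (at x)" by simp
    then have "(\<psi> has_real_derivative 0) (at x)"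
      by (rule has_field_derivative_transform_within_open[where S = "- K"])
         (use K that compact_imp_closed in auto)
    then show ?thesis by (rule DERIV_imp_deriv)
  qed
  moreover have "(deriv ^^ k) (deriv \<psi>) field_differentiable at x" for k x
  proof -
    have "(deriv ^^ Suc k) \<psi> field_differentiable at x"
      using assms unfolding test_functions_def by blast
    then show ?thesis by (simp add: funpow_swap1)
  qed
  ultimately show ?thesis using K unfolding test_functions_def by blast
qed

text \<open>Serves to correct a test function to mean zero by subtracting a multiple of a fixed
  bump.\<close>

lemma test_function_diff_scale:
  assumes \<psi>: "\<psi> \<in> test_functions L" and \<rho>: "\<rho> \<in> test_functions L"
  shows "(\<lambda>x. \<psi> x - c * \<rho> x) \<in> test_functions L"
proof -
  have d: "(deriv ^^ k) \<psi> field_differentiable at x" "(deriv ^^ k) \<rho> field_differentiable at x" for k x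
    using assms unfolding test_functions_def by blast+
  have eq: "(deriv ^^ k) (\<lambda>x. \<psi> x - c * \<rho> x) = (\<lambda>x. (deriv ^^ k) \<psi> x - c * (deriv ^^ k) \<rho> x)" for k
  proof (induction k)
    case (Suc k)
    have "((\<lambda>x. (deriv ^^ k) \<psi> x - c * (deriv ^^ k) \<rho> x) has_real_derivative
           deriv ((deriv ^^ k) \<psi>) x - c * deriv ((deriv ^^ k) \<rho>) x) (at x)" for x
      using d[of k x, THEN field_differentiable_derivI] by (auto intro!: derivative_intros DERIV_cmult)
    with Suc show ?case by (auto simp: DERIV_imp_deriv)
  qed simp
  have "(deriv ^^ k) (\<lambda>x. \<psi> x - c * \<rho> x) field_differentiable at x" for k x
    unfolding eq using d by (intro field_differentiable_diff field_differentiable_mult) auto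
  moreover obtain K where "compact K" "K \<subseteq> {0<..<L}" "\<And>x. x \<notin> K \<Longrightarrow> \<psi> x = 0"
    using \<psi> by (auto simp: test_functions_def)
  moreover obtain K' where "compact K'" "K' \<subseteq> {0<..<L}" "\<And>x. x \<notin> K' \<Longrightarrow> \<rho> x = 0"
    using \<rho> by (auto simp: test_functions_def)
  ultimately show ?thesis
    unfolding test_functions_def by (fastforce intro!: exI[of _ "K \<union> K'"])
qed

text \<open>The primitive started at 0 vanishes to the left of the support; to the right of it, it
  equals the full integral, so mean zero is what gives compact support.\<close>

lemma test_function_antiderivative:
  assumes \<psi>: "\<psi> \<in> test_functions L" and zero: "integral {0..L} \<psi> = 0"
  obtains \<Psi> where "\<Psi> \<in> test_functions L" "deriv \<Psi> = \<psi>"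
proof -
  define \<Psi> where "\<Psi> x = (if x < 0 then 0 else integral {0..x} \<psi>)" for x
  obtain K where K: "compact K" "K \<subseteq> {0<..<L}" "\<And>x. x \<notin> K \<Longrightarrow> \<psi> x = 0"
    using \<psi> by (auto simp: test_functions_def)
  have int: "\<psi> integrable_on {x..y}" for x y
    by (intro integrable_continuous_real test_function_continuous[OF \<psi>])
  \<comment> \<open>Moving the base point to the left of both 0 and \<open>x\<close> puts
    \<open>x\<close> in the interior of the interval to which the fundamental theorem is applied,
    also when x \<le> 0.\<close>
  have shift: "\<Psi> x = integral {b..x} \<psi>" if "b \<le> 0" "b \<le> x" for b x
  proof -
    have "integral {b..min 0 x} \<psi> = integral {b..min 0 x} (\<lambda>_. 0)"
      by (rule integral_cong) (use test_function_outside[OF \<psi>] in auto)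
    then show ?thesis
      using that Henstock_Kurzweil_Integration.integral_combine[of b 0 x \<psi>] int
      by (auto simp: \<Psi>_def min_def split: if_splits)
  qed
  have D: "(\<Psi> has_real_derivative \<psi> x) (at x)" for x
  proof -
    define b where "b = min 0 x - 1"
    have "((\<lambda>u. integral {b..u} \<psi>) has_real_derivative \<psi> x) (at x within {b..x+1})"
      by (rule integral_has_real_derivative) (auto simp: b_def test_function_continuous[OF \<psi>])
    then have "((\<lambda>u. integral {b..u} \<psi>) has_real_derivative \<psi> x) (at x)"
      by (subst (asm) at_within_interior) (auto simp: b_def)
    then show ?thesis
      by (rule has_field_derivative_transform_within_open[where S = "{b<..}"])
         (use shift[of b] in \<open>auto simp: b_def\<close>)
  qed
  have deriv: "deriv \<Psi> = \<psi>" using D by (auto simp: DERIV_imp_deriv)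
  have "(deriv ^^ k) \<Psi> field_differentiable at x" for k x
  proof (cases k)
    case 0
    then show ?thesis using D by (auto simp: field_differentiable_def)
  next
    case (Suc j)
    have "(deriv ^^ j) \<psi> field_differentiable at x"
      using \<psi> unfolding test_functions_def by blast
    then show ?thesis by (simp add: Suc funpow_Suc_right deriv del: funpow.simps)
  qed
  moreover have "\<exists>K. compact K \<and> K \<subseteq> {0<..<L} \<and> (\<forall>x. x \<notin> K \<longrightarrow> \<Psi> x = 0)"
  proof (cases "K = {}")
    case True
    then have "\<psi> = (\<lambda>_. 0)" using K by auto
    then show ?thesis by (auto simp: \<Psi>_def intro: exI[of _ "{}"])
  next
    case False
    \<comment> \<open>\<open>K\<close> itself need not support \<Psi>, which may be a nonzero
      constant in the gaps of \<open>K\<close>; its convex hull does.\<close>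
    define s t where "s = Inf K" and "t = Sup K"
    have st: "s \<in> K" "t \<in> K" "\<And>x. x \<in> K \<Longrightarrow> s \<le> x \<and> x \<le> t"
      using K(1) False
      by (auto simp: s_def t_def compact_imp_closed compact_imp_bounded closed_contains_Inf closed_contains_Sup
               bounded_imp_bdd_above bounded_imp_bdd_below cInf_lower cSup_upper)
    have "\<Psi> x = 0" if "x \<notin> {s..t}" for x
    proof (cases "x < s")
      case True
      have "integral {0..x} \<psi> = integral {0..x} (\<lambda>_. 0)"
        by (rule integral_cong) (use st K True in force)
      then show ?thesis by (simp add: \<Psi>_def)
    next
      case False
      with that have x: "t < x" by auto
      have t: "0 < t" "t < L" using st K by auto
      have 1: "integral {x..y} \<psi> = 0" if "t < x" for x y
      proof -
        have "integral {x..y} \<psi> = integral {x..y} (\<lambda>_. 0)"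
          by (rule integral_cong) (use st K that in force)
        then show ?thesis by simp
      qed
      show ?thesis
      proof (cases "x \<le> L")
        case True
        then show ?thesis
          using Henstock_Kurzweil_Integration.integral_combine[of 0 x L \<psi>] int 1[OF x, of L] zero x t
          by (simp add: \<Psi>_def)
      next
        case False
        then show ?thesis
          using Henstock_Kurzweil_Integration.integral_combine[of 0 L x \<psi>] int 1[of L x] zero x t
          by (simp add: \<Psi>_def)
      qed
    qed
    then show ?thesis
      using st(1,2) K(2) by (intro exI[of _ "{s..t}"]) force
  qed
  ultimately have "\<Psi> \<in> test_functions L"
    unfolding test_functions_def by blast
  with deriv that show thesis by blast
qed

subsection \<open>The fundamental lemma of the calculus of variations\<close>

text \<open>The positive and negative parts of \<open>f\<close> are densities of two measures that
  are finite and equal on all rays, hence equal. As \<open>ennreal\<close> cuts negative values to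
  0, equality of the densities for \<open>f\<close> and \<open>- f\<close> forces f = 0.\<close>

lemma AE_lborel_eq_0:
  fixes f :: "real \<Rightarrow> real"
  assumes f: "integrable lborel f"
    and zero: "\<And>x. (LINT y|lborel. indicator {x<..} y * f y) = 0"
  shows "AE x in lborel. f x = 0"
proof -
  have [measurable]: "f \<in> borel_measurable borel"
    using borel_measurable_integrable[OF f] by simp
  let ?P = "density lborel (\<lambda>y. ennreal (f y))"
  let ?N = "density lborel (\<lambda>y. ennreal (- f y))"
  have int: "integrable lborel (\<lambda>y. indicator {x<..} y * f y)" for x
    using integrable_mult_indicator[OF _ f, of "{x<..}"] by simp
  have fin: "(\<integral>\<^sup>+y. ennreal (h y) \<partial>lborel) < \<infinity>" if "integrable lborel h" for h :: "real \<Rightarrow> real"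
    using integrableD(2,3)[OF that] by (auto simp: less_top)
  have P: "emeasure ?P {x<..} = (\<integral>\<^sup>+y. ennreal (indicator {x<..} y * f y) \<partial>lborel)" for x
    by (subst emeasure_density) (auto intro!: nn_integral_cong simp: indicator_def)
  have N: "emeasure ?N {x<..} = (\<integral>\<^sup>+y. ennreal (- (indicator {x<..} y * f y)) \<partial>lborel)" for x
    by (subst emeasure_density) (auto intro!: nn_integral_cong simp: indicator_def)
  have "?P = ?N"
  proof (rule measure_eqI_lessThan)
    fix x
    show "emeasure ?P {x<..} < \<infinity>"
      unfolding P by (rule fin[OF int])
    have "enn2real (\<integral>\<^sup>+y. ennreal (indicator {x<..} y * f y) \<partial>lborel) =
          enn2real (\<integral>\<^sup>+y. ennreal (- (indicator {x<..} y * f y)) \<partial>lborel)"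
      using zero[of x] real_lebesgue_integral_def[OF int, of x] by simp
    then show "emeasure ?P {x<..} = emeasure ?N {x<..}"
      unfolding P N using fin[OF int, of x] fin[OF integrable_minus[OF int], of x]
      by (metis ennreal_enn2real less_top infinity_ennreal_def)
  qed auto
  moreover have "(\<integral>\<^sup>+y. ennreal (f y) \<partial>lborel) \<noteq> \<infinity>"
    using fin[OF f] by simp
  ultimately have "AE y in lborel. ennreal (f y) = ennreal (- f y)"
    by (subst (asm) finite_density_unique) auto
  then show ?thesis
    by eventually_elim (metis ennreal_eq_0_iff ennreal_inj ennreal_neg linorder_le_cases
        neg_0_le_iff_le neg_le_0_iff_le order_antisym)
qed

lemma test_function_measurable:
  assumes "\<psi> \<in> test_functions L"
  shows "\<psi> \<in> borel_measurable (lebesgue_on {0<..<L})"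
  by (rule continuous_imp_measurable_on_sets_lebesgue) (use test_function_continuous[OF assms] in auto)

lemma test_function_bounded:
  assumes "\<psi> \<in> test_functions L"
  obtains B where "\<And>x. \<bar>\<psi> x\<bar> \<le> B"
proof -
  have "compact (\<psi> ` {0..L})"
    by (intro compact_continuous_image test_function_continuous[OF assms]) auto
  then obtain B where "\<forall>y \<in> \<psi> ` {0..L}. \<bar>y\<bar> \<le> B"
    using compact_imp_bounded bounded_real by blast
  moreover have "\<psi> x = 0" if "x \<notin> {0..L}" for x
    using that by (intro test_function_outside[OF assms]) auto
  ultimately have "\<bar>\<psi> x\<bar> \<le> max 0 B" for x
    by (cases "x \<in> {0..L}") (simp_all add: le_max_iff_disj)
  with that show thesis by blast
qed

lemma integrable_mult_test_function:
  assumes f: "integrable (lebesgue_on {0<..<L}) f" and \<psi>: "\<psi> \<in> test_functions L"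
  shows "integrable (lebesgue_on {0<..<L}) (\<lambda>x. f x * \<psi> x)"
proof -
  obtain B where B: "\<And>x. \<bar>\<psi> x\<bar> \<le> B" using test_function_bounded[OF \<psi>] by blast
  have [measurable]: "f \<in> borel_measurable (lebesgue_on {0<..<L})"
    "\<psi> \<in> borel_measurable (lebesgue_on {0<..<L})"
    using f test_function_measurable[OF \<psi>] by auto
  show ?thesis
  proof (rule Bochner_Integration.integrable_bound[of _ "\<lambda>x. B * \<bar>f x\<bar>"])
    have "\<bar>\<psi> x\<bar> \<le> \<bar>B\<bar>" for x using B[of x] by linarith
    then have "\<bar>f x\<bar> * \<bar>\<psi> x\<bar> \<le> \<bar>f x\<bar> * \<bar>B\<bar>" for x
      by (intro mult_left_mono) auto
    then show "AE x in lebesgue_on {0<..<L}. norm (f x * \<psi> x) \<le> norm (B * \<bar>f x\<bar>)"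
      by (intro AE_I2) (simp add: abs_mult mult.commute[of "\<bar>B\<bar>"])
  qed (use f in auto)
qed

text \<open>The aim is to reach indicators of rays, so that \<open>AE_lborel_eq_0\<close> applies to
  the extension of \<open>f\<close> by 0. This takes two dominated limits: bumps give intervals
  compactly contained in (0,L), and these exhaust (s,L).\<close>

lemma fundamental_lemma:
  assumes f: "integrable (lebesgue_on {0<..<L}) f"
    and zero: "\<And>\<psi>. \<psi> \<in> test_functions L \<Longrightarrow> (LINT x|lebesgue_on {0<..<L}. f x * \<psi> x) = 0"
  shows "AE x in lebesgue_on {0<..<L}. f x = 0"
proof -
  let ?M = "lebesgue_on {0<..<L}"
  have [measurable]: "f \<in> borel_measurable ?M" using f by auto
  \<comment> \<open>Common form of both limits: multipliers bounded by 1, with |f| as the dominating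
    function.\<close>
  have dom: "(LINT x|?M. f x * w x) = 0"
    if lim: "\<And>x. (\<lambda>n. k n x) \<longlonglongrightarrow> w x" and k: "\<And>n. (LINT x|?M. f x * k n x) = 0"
      and kM [measurable]: "\<And>n. k n \<in> borel_measurable ?M" and k01: "\<And>n x. \<bar>k n x\<bar> \<le> 1"
    for k :: "nat \<Rightarrow> real \<Rightarrow> real" and w
  proof -
    have [measurable]: "w \<in> borel_measurable ?M"
      by (rule borel_measurable_LIMSEQ_real[OF lim kM])
    have "(\<lambda>n. LINT x|?M. f x * k n x) \<longlonglongrightarrow> (LINT x|?M. f x * w x)"
    proof (rule integral_dominated_convergence[where w = "\<lambda>x. \<bar>f x\<bar>"])
      show "AE x in ?M. (\<lambda>n. f x * k n x) \<longlonglongrightarrow> f x * w x"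
        by (intro AE_I2 tendsto_intros lim)
      show "AE x in ?M. norm (f x * k n x) \<le> \<bar>f x\<bar>" for n
        by (intro AE_I2) (use k01 in \<open>auto simp: abs_mult intro!: mult_left_le\<close>)
    qed (use f in auto)
    then show ?thesis using k by (simp add: LIMSEQ_const_iff)
  qed
  have compact_sub: "(LINT x|?M. f x * indicator {s<..<t} x) = 0" if "0 < s" "t < L" for s t
    by (rule dom[of "bump s t"])
       (use that bump_tendsto_indicator bump_bounds in
         \<open>auto intro!: zero bump_test_function test_function_measurable[OF bump_test_function]\<close>)
  \<comment> \<open>Both ends are moved inwards by 1/(n+1), because a bump reaching 0 or L has no
    compact support in (0,L).\<close>
  have sub: "(LINT x|?M. f x * indicator {s<..<L} x) = 0" if "0 \<le> s" for s
  proof (rule dom[of "\<lambda>n. indicator {s + inverse (real (Suc n)) <..< L - inverse (real (Suc n))}"])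
    fix x
    have 1: "(\<lambda>n. s + inverse (real (Suc n))) \<longlonglongrightarrow> s + 0" "(\<lambda>n. L - inverse (real (Suc n))) \<longlonglongrightarrow> L - 0"
      by (intro tendsto_intros LIMSEQ_inverse_real_of_nat)+
    show "(\<lambda>n. indicat_real {s + inverse (real (Suc n)) <..< L - inverse (real (Suc n))} x) \<longlonglongrightarrow> indicator {s<..<L} x"
    proof (cases "x \<in> {s<..<L}")
      case True
      then have "\<forall>\<^sub>F n in sequentially. s + inverse (real (Suc n)) < x"
        "\<forall>\<^sub>F n in sequentially. x < L - inverse (real (Suc n))"
        using order_tendstoD(2)[OF 1(1), of x] order_tendstoD(1)[OF 1(2), of x] by auto
      then have "\<forall>\<^sub>F n in sequentially.
          indicat_real {s + inverse (real (Suc n)) <..< L - inverse (real (Suc n))} x = 1"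
        by eventually_elim auto
      then show ?thesis using True by (simp add: tendsto_eventually)
    next
      case False
      have "x \<notin> {s + inverse (real (Suc n)) <..< L - inverse (real (Suc n))}" for n
      proof -
        have "inverse (real (Suc n)) > 0" by simp
        with False show ?thesis unfolding greaterThanLessThan_iff by linarith
      qed
      then show ?thesis using False by simp
    qed
  next
    fix n
    have "inverse (real (Suc n)) > 0" by simp
    then show "(LINT x|?M. f x * indicat_real {s + inverse (real (Suc n)) <..< L - inverse (real (Suc n))} x) = 0"
      using that by (intro compact_sub) linarith+
  next
    fix n
    show "indicat_real {s + inverse (real (Suc n)) <..< L - inverse (real (Suc n))} \<in> borel_measurable ?M"
      by (intro borel_measurable_indicator' measurable_restrict_space1) auto
  qed (auto simp: indicator_def)
  let ?F = "\<lambda>x. indicator {0<..<L} x * f x"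
  have F: "integrable lebesgue ?F"
    using f by (subst (asm) integrable_restrict_space) auto
  \<comment> \<open>The extension is only Lebesgue measurable, whereas the comparison of measures
    lives on Borel sets; hence a Borel modification.\<close>
  then obtain g where g: "g \<in> borel_measurable lborel" and eq: "AE x in lborel. ?F x = g x"
    using completion_ex_borel_measurable_real[OF borel_measurable_integrable[OF F]] by auto
  have eq': "AE x in lebesgue. ?F x = g x" using eq by (rule AE_completion)
  have [measurable]: "g \<in> borel_measurable lborel" by fact
  have gl: "g \<in> borel_measurable lebesgue" using g by (rule measurable_completion)
  have "integrable lebesgue g"
    using integrable_cong_AE_imp[OF F gl] eq' by (auto elim: eventually_mono)
  then have "integrable lborel g"
    using integrable_completion[OF g] by simp
  moreover have "(LINT y|lborel. indicator {x<..} y * g y) = 0" for x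
  proof -
    have "(LINT y|lborel. indicator {x<..} y * g y) = (LINT y|lebesgue. indicator {x<..} y * g y)"
      by (rule integral_completion[symmetric]) auto
    \<comment> \<open>A ray from \<open>x\<close> meets (0,L) in (max x 0, L), which is empty if x
      \<ge> L.\<close>
    also have "\<dots> = (LINT y|lebesgue. indicator {0<..<L} y *\<^sub>R (f y * indicator {max x 0<..<L} y))"
    proof (rule integral_cong_AE)
      show "(\<lambda>y. indicator {x<..} y * g y) \<in> borel_measurable lebesgue"
        by (rule measurable_completion) simp
      have "(\<lambda>y. indicator {max x 0<..<L} y * ?F y) \<in> borel_measurable lebesgue"
        by (intro borel_measurable_times borel_measurable_indicator borel_measurable_integrable[OF F]) auto
      then show "(\<lambda>y. indicator {0<..<L} y *\<^sub>R (f y * indicator {max x 0<..<L} y)) \<in> borel_measurable lebesgue"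
        by (simp add: mult_ac)
      show "AE y in lebesgue. indicator {x<..} y * g y = indicator {0<..<L} y *\<^sub>R (f y * indicator {max x 0<..<L} y)"
        using eq' by eventually_elim (auto simp: indicator_def split: if_splits)
    qed
    also have "\<dots> = (LINT y|?M. f y * indicator {max x 0<..<L} y)"
      by (rule integral_restrict_space[symmetric]) auto
    also have "\<dots> = 0" by (rule sub) auto
    finally show ?thesis .
  qed
  ultimately have "AE x in lborel. g x = 0" by (rule AE_lborel_eq_0)
  then have "AE x in lebesgue. g x = 0" by (rule AE_completion)
  with eq' have "AE x in lebesgue. x \<in> {0<..<L} \<longrightarrow> f x = 0"
    by eventually_elim (auto simp: indicator_def split: if_splits)
  then show ?thesis by (subst AE_restrict_space_iff) auto
qed

lemma integrable_test_function:
  assumes "\<psi> \<in> test_functions L"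
  shows "integrable (lebesgue_on {0<..<L}) \<psi>"
  using integrable_mult_test_function[OF _ assms, of "\<lambda>_. 1"]
  by (simp add: finite_measure.integrable_const finite_measure_lebesgue_on)

lemma LINT_test_function:
  assumes "\<psi> \<in> test_functions L"
  shows "(LINT x|lebesgue_on {0<..<L}. \<psi> x) = integral {0..L} \<psi>"
  using lebesgue_integral_eq_integral[OF integrable_test_function[OF assms]]
    integral_open_interval_real[of 0 L \<psi>] by simp

text \<open>Only derivatives of test functions may be tested, that is, test functions of mean zero.
  Subtracting from \<psi> the multiple of a fixed bump with the same integral makes it admissible,
  and the subtracted part contributes a constant times the integral of \<psi>.\<close>

lemma du_Bois_Reymond:
  assumes L: "L > 0" and w: "integrable (lebesgue_on {0<..<L}) w"
    and zero: "\<And>\<psi>. \<psi> \<in> test_functions L \<Longrightarrow> (LINT x|lebesgue_on {0<..<L}. w x * deriv \<psi> x) = 0"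
  obtains c where "AE x in lebesgue_on {0<..<L}. w x = c"
proof -
  let ?M = "lebesgue_on {0<..<L}"
  let ?b = "bump (L/3) (2*L/3) 1"
  have b: "?b \<in> test_functions L" using L by (intro bump_test_function) auto
  define I where "I = integral {0..L} ?b"
  \<comment> \<open>A nonnegative continuous function with integral 0 vanishes, but the bump is
    positive at the midpoint L/2.\<close>
  have "I \<noteq> 0"
  proof
    assume "I = 0"
    then have "(?b has_integral 0) (cbox 0 L)"
      unfolding I_def cbox_interval
      by (metis b has_integral_integral integrable_continuous_real test_function_continuous)
    then have "?b (L/2) = 0"
      by (rule has_integral_0_cbox_imp_0[rotated 2])
         (use L test_function_continuous[OF b] bump_bounds in auto)
    with bump_bounds(4)[of "L/2" "L/3" "2*L/3" 1] L show False by simp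
  qed
  \<comment> \<open>The bump-weighted mean of \<open>w\<close>, the only candidate for the
    constant.\<close>
  define c where "c = (LINT x|?M. w x * ?b x) / I"
  have "(LINT x|?M. (w x - c) * \<psi> x) = 0" if \<psi>: "\<psi> \<in> test_functions L" for \<psi>
  proof -
    define k where "k = integral {0..L} \<psi> / I"
    let ?d = "\<lambda>x. \<psi> x - k * ?b x"
    have d: "?d \<in> test_functions L" by (rule test_function_diff_scale[OF \<psi> b])
    have cont: "\<psi> integrable_on {0..L}" "?b integrable_on {0..L}"
      by (intro integrable_continuous_real test_function_continuous[OF \<psi>] test_function_continuous[OF b])+
    then have "integral {0..L} ?d = integral {0..L} \<psi> - k * I"
      by (subst Henstock_Kurzweil_Integration.integral_diff)
         (simp_all add: I_def integrable_on_mult_right del: One_nat_def)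
    then have "integral {0..L} ?d = 0"
      using \<open>I \<noteq> 0\<close> by (simp add: k_def)
    then obtain \<Psi> where "\<Psi> \<in> test_functions L" "deriv \<Psi> = ?d"
      using test_function_antiderivative[OF d] by blast
    then have "(LINT x|?M. w x * ?d x) = 0"
      using zero[of \<Psi>] by simp
    moreover have "(LINT x|?M. w x * ?d x) = (LINT x|?M. w x * \<psi> x) - k * (LINT x|?M. w x * ?b x)"
    proof -
      have "(LINT x|?M. w x * ?d x) = (LINT x|?M. w x * \<psi> x - k * (w x * ?b x))"
        by (rule Bochner_Integration.integral_cong) (simp_all add: right_diff_distrib)
      then show ?thesis
        using integrable_mult_test_function[OF w \<psi>] integrable_mult_test_function[OF w b]
        by (simp del: One_nat_def)
    qed
    moreover have "(LINT x|?M. (w x - c) * \<psi> x) = (LINT x|?M. w x * \<psi> x) - c * integral {0..L} \<psi>"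
      using integrable_mult_test_function[OF w \<psi>] integrable_test_function[OF \<psi>] LINT_test_function[OF \<psi>]
      by (simp add: left_diff_distrib)
    ultimately show ?thesis using \<open>I \<noteq> 0\<close> by (simp add: c_def k_def field_simps)
  qed
  moreover have "integrable ?M (\<lambda>x. w x - c)"
    using w by (simp add: finite_measure.integrable_const finite_measure_lebesgue_on)
  ultimately have "AE x in ?M. w x - c = 0" by (intro fundamental_lemma)
  then have "AE x in ?M. w x = c" by simp
  then show thesis by (rule that)
qed

subsection \<open>Sobolev functions on an interval\<close>

lemma finite_measure_Ioo: "finite_measure (lebesgue_on {0<..<L::real})"
  by (simp add: finite_measure_lebesgue_on)

section \<open>L^p estimates on a bounded interval\<close>

text \<open>Stands in for Hoelder's inequality: beyond the threshold \<delta> the factor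
  (|x|/\<delta>)^(p-1) is at least 1, below it the term \<delta> suffices.\<close>

lemma abs_le_powr:
  fixes x \<delta> p :: real
  assumes "p \<ge> 1" "\<delta> > 0"
  shows "\<bar>x\<bar> \<le> \<delta> + \<delta> powr (1 - p) * \<bar>x\<bar> powr p"
proof (cases "\<bar>x\<bar> \<le> \<delta>")
  case True
  then show ?thesis by (simp add: add_increasing2)
next
  case False
  then have "\<delta> powr (p - 1) \<le> \<bar>x\<bar> powr (p - 1)"
    using assms by (intro powr_mono2) auto
  then have "\<delta> powr (1 - p) * \<delta> powr (p - 1) \<le> \<delta> powr (1 - p) * \<bar>x\<bar> powr (p - 1)"
    by (intro mult_left_mono) auto
  then have "1 \<le> \<delta> powr (1 - p) * \<bar>x\<bar> powr (p - 1)"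
    using assms by (simp flip: powr_add)
  then have "\<bar>x\<bar> * 1 \<le> \<bar>x\<bar> * (\<delta> powr (1 - p) * \<bar>x\<bar> powr (p - 1))"
    by (intro mult_left_mono) auto
  also have "\<dots> = \<delta> powr (1 - p) * \<bar>x\<bar> powr p"
    using False assms by (simp add: powr_diff)
  finally show ?thesis using assms by simp
qed

lemma Lp_integrable:
  assumes f: "f \<in> Lp L p" and p: "p \<ge> 1"
  shows "integrable (lebesgue_on {0<..<L}) f"
proof (rule Bochner_Integration.integrable_bound[of _ "\<lambda>x. 1 + \<bar>f x\<bar> powr p"])
  show "AE x in lebesgue_on {0<..<L}. norm (f x) \<le> norm (1 + \<bar>f x\<bar> powr p)"
    using abs_le_powr[OF p, of 1] by (intro AE_I2) simp
qed (use f in \<open>auto simp: Lp_def finite_measure.integrable_const[OF finite_measure_Ioo]\<close>)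

text \<open>The norm bound itself is taken as the threshold in \<open>abs_le_powr\<close>: the
  constant contributes \<delta> L and the power term \<delta>^(1-p) \<delta>^p = \<delta>.\<close>

lemma LINT_abs_le_Lp_norm:
  assumes f: "f \<in> Lp L p" and p: "p \<ge> 1" and L: "L > 0"
    and le: "Lp_norm L p f \<le> \<delta>" and \<delta>: "\<delta> > 0"
  shows "(LINT x|lebesgue_on {0<..<L}. \<bar>f x\<bar>) \<le> \<delta> * (L + 1)"
proof -
  let ?M = "lebesgue_on {0<..<L}"
  let ?I = "LINT x|?M. \<bar>f x\<bar> powr p"
  have I: "?I = Lp_norm L p f powr p"
    using p by (simp add: Lp_norm_def powr_powr)
  also have "\<dots> \<le> \<delta> powr p"
    using le p by (intro powr_mono2) (auto simp: Lp_norm_def)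
  finally have I: "?I \<le> \<delta> powr p" .
  have int: "integrable ?M (\<lambda>x. \<bar>f x\<bar> powr p)" using f by (simp add: Lp_def)
  have "(LINT x|?M. \<bar>f x\<bar>) \<le> (LINT x|?M. \<delta> + \<delta> powr (1 - p) * \<bar>f x\<bar> powr p)"
    using Lp_integrable[OF f p] int abs_le_powr[OF p \<delta>]
    by (intro integral_mono) (auto simp: finite_measure.integrable_const[OF finite_measure_Ioo])
  also have "\<dots> = \<delta> * L + \<delta> powr (1 - p) * ?I"
    using int L by (simp add: finite_measure.integrable_const[OF finite_measure_Ioo]
        measure_restrict_space)
  also have "\<dots> \<le> \<delta> * L + \<delta> powr (1 - p) * \<delta> powr p"
    using I by (intro add_left_mono mult_left_mono) auto
  also have "\<dots> = \<delta> * (L + 1)"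
    using \<delta> by (simp add: algebra_simps flip: powr_add)
  finally show ?thesis .
qed

lemma powr_add_le:
  fixes x y p :: real
  assumes "0 \<le> x" "0 \<le> y" "0 \<le> p"
  shows "(x + y) powr p \<le> 2 powr p * (x powr p + y powr p)"
proof -
  have "(x + y) powr p \<le> (2 * max x y) powr p"
    using assms by (intro powr_mono2) auto
  also have "\<dots> = 2 powr p * max x y powr p"
    using assms by (simp add: powr_mult)
  also have "\<dots> \<le> 2 powr p * (x powr p + y powr p)"
    by (intro mult_left_mono) (auto simp: max_def)
  finally show ?thesis .
qed

lemma Lp_diff:
  assumes f: "f \<in> Lp L p" and g: "g \<in> Lp L p" and p: "p \<ge> 0"
  shows "(\<lambda>x. f x - g x) \<in> Lp L p"
proof -
  have [measurable]: "f \<in> borel_measurable (lebesgue_on {0<..<L})"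
    "g \<in> borel_measurable (lebesgue_on {0<..<L})"
    using f g by (auto simp: Lp_def)
  have "integrable (lebesgue_on {0<..<L}) (\<lambda>x. \<bar>f x - g x\<bar> powr p)"
  proof (rule Bochner_Integration.integrable_bound
      [of _ "\<lambda>x. 2 powr p * (\<bar>f x\<bar> powr p + \<bar>g x\<bar> powr p)"])
    have "\<bar>f x - g x\<bar> powr p \<le> 2 powr p * (\<bar>f x\<bar> powr p + \<bar>g x\<bar> powr p)" for x
      using powr_mono2[OF p abs_ge_zero abs_triangle_ineq4, of "f x" "g x"]
        powr_add_le[of "\<bar>f x\<bar>" "\<bar>g x\<bar>" p] p by simp
    then show "AE x in lebesgue_on {0<..<L}. norm (\<bar>f x - g x\<bar> powr p)
        \<le> norm (2 powr p * (\<bar>f x\<bar> powr p + \<bar>g x\<bar> powr p))"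
      by (intro AE_I2) simp
  qed (use f g in \<open>auto simp: Lp_def\<close>)
  then show ?thesis by (simp add: Lp_def)
qed

lemma test_function_Lp:
  assumes \<psi>: "\<psi> \<in> test_functions L" and p: "p \<ge> 0"
  shows "\<psi> \<in> Lp L p"
proof -
  note [measurable] = test_function_measurable[OF \<psi>]
  obtain B where B: "\<And>x. \<bar>\<psi> x\<bar> \<le> B" using test_function_bounded[OF \<psi>] by blast
  have "integrable (lebesgue_on {0<..<L}) (\<lambda>x. \<bar>\<psi> x\<bar> powr p)"
    by (rule finite_measure.integrable_const_bound[OF finite_measure_Ioo, of _ "B powr p"])
       (use B p in \<open>auto intro!: AE_I2 powr_mono2\<close>)
  then show ?thesis by (simp add: Lp_def)
qed

section \<open>Weak derivatives: test functions, uniqueness, recovery of u by integration\<close>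

lemma test_function_by_parts:
  assumes \<psi>: "\<psi> \<in> test_functions L" and \<eta>: "\<eta> \<in> test_functions L" and L: "L > 0"
  shows "(LINT x|lebesgue_on {0<..<L}. \<psi> x * deriv \<eta> x) =
    - (LINT x|lebesgue_on {0<..<L}. deriv \<psi> x * \<eta> x)"
proof -
  let ?M = "lebesgue_on {0<..<L}"
  note d = test_function_has_derivative
  have i1: "integrable ?M (\<lambda>x. \<psi> x * deriv \<eta> x)" and i2: "integrable ?M (\<lambda>x. deriv \<psi> x * \<eta> x)"
    by (intro integrable_mult_test_function integrable_test_function test_function_deriv \<psi> \<eta>)+
  have "((\<lambda>x. \<psi> x * \<eta> x) has_vector_derivative \<psi> x * deriv \<eta> x + deriv \<psi> x * \<eta> x) (at x within {0..L})" for x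
    using DERIV_mult[OF d[OF \<psi>, of x] d[OF \<eta>, of x]]
    by (auto simp: has_real_derivative_iff_has_vector_derivative has_vector_derivative_at_within algebra_simps)
  then have "((\<lambda>x. \<psi> x * deriv \<eta> x + deriv \<psi> x * \<eta> x) has_integral
      \<psi> L * \<eta> L - \<psi> 0 * \<eta> 0) {0..L}"
    using L by (intro fundamental_theorem_of_calculus) auto
  then have "integral {0<..<L} (\<lambda>x. \<psi> x * deriv \<eta> x + deriv \<psi> x * \<eta> x) = 0"
    using test_function_outside[OF \<eta>]
    by (simp add: integral_open_interval_real[symmetric] integral_unique)
  then have "(LINT x|?M. \<psi> x * deriv \<eta> x + deriv \<psi> x * \<eta> x) = 0"
    using i1 i2 by (subst lebesgue_integral_eq_integral) auto
  then show ?thesis using i1 i2 by simp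
qed

lemma test_function_W1p:
  assumes "\<psi> \<in> test_functions L" "L > 0" "p \<ge> 0"
  shows "W1p L p \<psi> (deriv \<psi>)"
  using assms by (simp add: W1p_def test_function_Lp test_function_deriv test_function_by_parts)

lemma test_function_W1p0:
  assumes \<psi>: "\<psi> \<in> test_functions L" and "L > 0" "p > 0"
  shows "\<psi> \<in> W1p0 L p"
  unfolding W1p0_def
proof (intro CollectI conjI exI allI impI)
  show "continuous_on {0..L} \<psi>" by (rule test_function_continuous[OF \<psi>])
  show "W1p L p \<psi> (deriv \<psi>)" using assms by (intro test_function_W1p) auto
  fix \<epsilon> :: real assume "\<epsilon> > 0"
  then have "Lp_norm L p (\<lambda>x. \<psi> x - \<psi> x) + Lp_norm L p (\<lambda>x. deriv \<psi> x - deriv \<psi> x) < \<epsilon>"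
    by (simp add: Lp_norm_def)
  then show "\<exists>\<psi>'\<in>test_functions L. Lp_norm L p (\<lambda>x. \<psi> x - \<psi>' x) +
      Lp_norm L p (\<lambda>x. deriv \<psi> x - deriv \<psi>' x) < \<epsilon>"
    using \<psi> by blast
qed

text \<open>\<open>W1p\<close> is a relation, so the derivative witnessing membership in
  \<open>W1p0\<close> and the one occurring in the weak equation have to be identified.\<close>

lemma W1p_unique:
  assumes v: "W1p L p u v" and w: "W1p L p u w" and p: "p \<ge> 1"
  shows "AE x in lebesgue_on {0<..<L}. v x = w x"
proof -
  let ?M = "lebesgue_on {0<..<L}"
  have int: "integrable ?M v" "integrable ?M w"
    using v w p by (auto simp: W1p_def intro: Lp_integrable)
  have "(LINT x|?M. (v x - w x) * \<psi> x) = 0" if \<psi>: "\<psi> \<in> test_functions L" for \<psi>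
  proof -
    have "(LINT x|?M. (v x - w x) * \<psi> x) = (LINT x|?M. v x * \<psi> x) - (LINT x|?M. w x * \<psi> x)"
      using int[THEN integrable_mult_test_function, OF \<psi>] by (simp add: left_diff_distrib)
    also have "\<dots> = 0"
    proof -
      have "(LINT x|?M. u x * deriv \<psi> x) = - (LINT x|?M. v x * \<psi> x)"
        "(LINT x|?M. u x * deriv \<psi> x) = - (LINT x|?M. w x * \<psi> x)"
        using v w \<psi> unfolding W1p_def by blast+
      then show ?thesis by linarith
    qed
    finally show ?thesis .
  qed
  then have "AE x in ?M. v x - w x = 0"
    using int by (intro fundamental_lemma) auto
  then show ?thesis by simp
qed

lemma integrable_imp_absolutely_integrable_Icc:
  fixes f :: "real \<Rightarrow> real"
  assumes "integrable (lebesgue_on {0<..<L}) f"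
  shows "f absolutely_integrable_on {0..L}"
  by (subst absolutely_integrable_on_Icc_iff_Ioo)
     (use assms in \<open>simp add: set_integrable_def integrable_restrict_space\<close>)

lemma LINT_eq_integral_Icc:
  fixes f :: "real \<Rightarrow> real"
  assumes "integrable (lebesgue_on {0<..<L}) f"
  shows "(LINT x|lebesgue_on {0<..<L}. f x) = integral {0..L} f"
  using lebesgue_integral_eq_integral[OF assms] integral_open_interval_real[of 0 L f] by simp

text \<open>Approximating test functions converge to \<open>u\<close> in L^1, and also uniformly to
  the primitive of \<open>v\<close>, since each is the integral from 0 of its derivative. So
  \<open>u\<close> and the primitive agree in L^1, and by continuity everywhere. The zero boundary
  value is inherited from the test functions.\<close>

lemma W1p0_antiderivative:
  assumes u: "u \<in> W1p0 L p" and p: "p \<ge> 1" and L: "L > 0"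
  obtains v where "W1p L p u v" "\<And>x. x \<in> {0..L} \<Longrightarrow> u x = integral {0..x} v"
proof -
  let ?M = "lebesgue_on {0<..<L}"
  from u obtain v where cont: "continuous_on {0..L} u" and W: "W1p L p u v"
    and approx: "\<And>\<epsilon>. \<epsilon> > 0 \<Longrightarrow> \<exists>\<psi> \<in> test_functions L.
           Lp_norm L p (\<lambda>x. u x - \<psi> x) + Lp_norm L p (\<lambda>x. v x - deriv \<psi> x) < \<epsilon>"
    unfolding W1p0_def mem_Collect_eq by metis
  have Lp: "u \<in> Lp L p" "v \<in> Lp L p" using W by (auto simp: W1p_def)
  have v: "v absolutely_integrable_on {0..L}"
    by (intro integrable_imp_absolutely_integrable_Icc Lp_integrable[OF Lp(2) p])
  define U where "U x = integral {0..x} v" for x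
  have U: "continuous_on {0..L} U"
    unfolding U_def using v by (intro indefinite_integral_continuous_1) (auto simp: absolutely_integrable_on_def)
  have "integral {0..L} (\<lambda>x. \<bar>u x - U x\<bar>) \<le> 0"
  proof (rule field_le_epsilon)
    fix e :: real assume "e > 0"
    \<comment> \<open>The two errors are \<delta> (L+1) and, after integrating the uniform bound
      over [0,L], \<delta> (L+1) L; they add up to e.\<close>
    define \<delta> where "\<delta> = e / ((L + 1) * (L + 1))"
    have \<delta>: "\<delta> > 0" using \<open>e > 0\<close> L by (simp add: \<delta>_def)
    obtain \<psi> where \<psi>: "\<psi> \<in> test_functions L"
      and less: "Lp_norm L p (\<lambda>x. u x - \<psi> x) + Lp_norm L p (\<lambda>x. v x - deriv \<psi> x) < \<delta>"
      using approx[OF \<delta>] by blast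
    have nonneg: "Lp_norm L p f \<ge> 0" for f by (simp add: Lp_norm_def)
    have le: "Lp_norm L p (\<lambda>x. u x - \<psi> x) \<le> \<delta>" "Lp_norm L p (\<lambda>x. v x - deriv \<psi> x) \<le> \<delta>"
      using less nonneg[of "\<lambda>x. u x - \<psi> x"] nonneg[of "\<lambda>x. v x - deriv \<psi> x"] by linarith+
    have d: "(\<lambda>x. u x - \<psi> x) \<in> Lp L p" "(\<lambda>x. v x - deriv \<psi> x) \<in> Lp L p"
      using Lp_diff[OF Lp(1) test_function_Lp[OF \<psi>]] p
        Lp_diff[OF Lp(2) test_function_Lp[OF test_function_deriv[OF \<psi>]]] by simp_all
    have dI: "(\<lambda>x. v x - deriv \<psi> x) absolutely_integrable_on {0..L}"
      by (intro integrable_imp_absolutely_integrable_Icc Lp_integrable[OF d(2) p])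
    have close: "\<bar>\<psi> x - U x\<bar> \<le> \<delta> * (L + 1)" if x: "x \<in> {0..L}" for x
    proof -
      have sub: "{0..x} \<subseteq> {0..L}" using x by auto
      have vx: "v integrable_on {0..x}"
        using absolutely_integrable_on_subinterval[OF v sub] by (simp add: absolutely_integrable_on_def)
      have dx: "(\<lambda>x. v x - deriv \<psi> x) absolutely_integrable_on {0..x}"
        by (rule absolutely_integrable_on_subinterval[OF dI sub])
      have "(deriv \<psi> has_integral \<psi> x - \<psi> 0) {0..x}"
        using x test_function_has_derivative[OF \<psi>]
        by (intro fundamental_theorem_of_calculus)
           (simp_all add: has_real_derivative_iff_has_vector_derivative has_vector_derivative_at_within)
      then have "deriv \<psi> integrable_on {0..x}" "integral {0..x} (deriv \<psi>) = \<psi> x"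
        using test_function_outside[OF \<psi>, of 0] by (auto dest: integral_unique)
      then have "U x - \<psi> x = integral {0..x} (\<lambda>x. v x - deriv \<psi> x)"
        using vx unfolding U_def by (simp add: Henstock_Kurzweil_Integration.integral_diff)
      then have "\<bar>\<psi> x - U x\<bar> = \<bar>integral {0..x} (\<lambda>x. v x - deriv \<psi> x)\<bar>"
        by linarith
      also have "\<dots> \<le> integral {0..x} (\<lambda>x. \<bar>v x - deriv \<psi> x\<bar>)"
        using dx integral_norm_bound_integral[of "\<lambda>x. v x - deriv \<psi> x" "{0..x}" "\<lambda>x. \<bar>v x - deriv \<psi> x\<bar>"]
        by (simp add: absolutely_integrable_on_def)
      also have "\<dots> \<le> integral {0..L} (\<lambda>x. \<bar>v x - deriv \<psi> x\<bar>)"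
        using dx dI sub by (intro integral_subset_le) (simp_all add: absolutely_integrable_on_def)
      also have "\<dots> = (LINT x|?M. \<bar>v x - deriv \<psi> x\<bar>)"
        by (rule LINT_eq_integral_Icc[symmetric]) (intro integrable_abs Lp_integrable[OF d(2) p])
      also have "\<dots> \<le> \<delta> * (L + 1)"
        by (rule LINT_abs_le_Lp_norm[OF d(2) p L le(2) \<delta>])
      finally show ?thesis .
    qed
    have c1: "continuous_on {0..L} (\<lambda>x. \<bar>u x - U x\<bar>)" "continuous_on {0..L} (\<lambda>x. \<bar>u x - \<psi> x\<bar>)"
      "continuous_on {0..L} (\<lambda>x. \<bar>\<psi> x - U x\<bar>)"
      by (intro continuous_intros cont U test_function_continuous[OF \<psi>])+
    have i1: "(\<lambda>x. \<bar>u x - U x\<bar>) integrable_on {0..L}" "(\<lambda>x. \<bar>u x - \<psi> x\<bar>) integrable_on {0..L}"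
      "(\<lambda>x. \<bar>\<psi> x - U x\<bar>) integrable_on {0..L}"
      using c1 by (simp_all add: integrable_continuous_real)
    have "integral {0..L} (\<lambda>x. \<bar>u x - U x\<bar>) \<le> integral {0..L} (\<lambda>x. \<bar>u x - \<psi> x\<bar> + \<bar>\<psi> x - U x\<bar>)"
      using i1 by (intro integral_le Henstock_Kurzweil_Integration.integrable_add) auto
    moreover have "\<dots> = integral {0..L} (\<lambda>x. \<bar>u x - \<psi> x\<bar>) + integral {0..L} (\<lambda>x. \<bar>\<psi> x - U x\<bar>)"
      using i1 by (intro Henstock_Kurzweil_Integration.integral_add)
    moreover have "integral {0..L} (\<lambda>x. \<bar>u x - \<psi> x\<bar>) \<le> \<delta> * (L + 1)"
      using LINT_abs_le_Lp_norm[OF d(1) p L le(1) \<delta>]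
        LINT_eq_integral_Icc[OF integrable_abs[OF Lp_integrable[OF d(1) p]]] by linarith
    moreover have "integral {0..L} (\<lambda>x. \<bar>\<psi> x - U x\<bar>) \<le> integral {0..L} (\<lambda>_. \<delta> * (L + 1))"
      using i1 close by (intro integral_le) auto
    moreover have "\<dots> = \<delta> * (L + 1) * L" using L by simp
    moreover have "\<delta> * (L + 1) + \<delta> * (L + 1) * L = e"
    proof -
      have "\<delta> * (L + 1) + \<delta> * (L + 1) * L = \<delta> * ((L + 1) * (L + 1))" by (simp add: algebra_simps)
      then show ?thesis using L by (simp add: \<delta>_def)
    qed
    ultimately show "integral {0..L} (\<lambda>x. \<bar>u x - U x\<bar>) \<le> 0 + e" by linarith
  qed
  moreover have int: "(\<lambda>x. \<bar>u x - U x\<bar>) integrable_on {0..L}"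
    by (intro integrable_continuous_real continuous_intros cont U)
  then have "integral {0..L} (\<lambda>x. \<bar>u x - U x\<bar>) \<ge> 0"
    by (intro Henstock_Kurzweil_Integration.integral_nonneg) auto
  ultimately have hi: "((\<lambda>x. \<bar>u x - U x\<bar>) has_integral 0) (cbox 0 L)"
    using int by (simp add: has_integral_integral)
  have "\<bar>u x - U x\<bar> = 0" if "x \<in> {0..L}" for x
  proof (rule has_integral_0_cbox_imp_0[OF _ _ hi])
    show "continuous_on (cbox 0 L) (\<lambda>x. \<bar>u x - U x\<bar>)"
      unfolding cbox_interval by (intro continuous_intros cont U)
  qed (use that L in auto)
  then show thesis using that[OF W] by (simp add: U_def)
qed

lemma W1p0_eq_integral:
  assumes u: "u \<in> W1p0 L p" and W: "W1p L p u w" and p: "p \<ge> 1" and L: "L > 0"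
    and x: "x \<in> {0..L}"
  shows "u x = integral {0..x} w"
proof -
  obtain v where v: "W1p L p u v" "\<And>x. x \<in> {0..L} \<Longrightarrow> u x = integral {0..x} v"
    using W1p0_antiderivative[OF u p L] by blast
  have "AE x in lebesgue. x \<in> {0<..<L} \<longrightarrow> v x = w x"
    using W1p_unique[OF v(1) W p] by (simp add: AE_restrict_space_iff)
  then obtain N where N: "N \<in> null_sets lebesgue" "{x. \<not> (x \<in> {0<..<L} \<longrightarrow> v x = w x)} \<subseteq> N"
    unfolding eventually_ae_filter space_completion space_lborel UNIV_def[symmetric] by auto
  have "integral {0..x} v = integral {0..x} w"
  proof (rule integral_spike)
    \<comment> \<open>The end points are added because the a.e. equality speaks about the open
      interval only.\<close>
    show "negligible (N \<union> {0, L})"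
      using N(1) by (intro negligible_Un) (simp_all add: negligible_iff_null_sets[of N])
    show "w y = v y" if "y \<in> {0..x} - (N \<union> {0, L})" for y
    proof -
      have "y \<in> {0<..<L}" using that x by auto
      then show ?thesis using that N(2) by auto
    qed
  qed
  then show ?thesis using v(2)[OF x] by simp
qed

subsection \<open>Substitution along an absolutely continuous function\<close>

lemma absolutely_integrable_continuous_times:
  fixes k v :: "real \<Rightarrow> real"
  assumes k: "continuous_on {a..b} k" and v: "v absolutely_integrable_on {a..b}"
  shows "(\<lambda>x. k x * \<bar>v x\<bar>) absolutely_integrable_on {a..b}"
proof (rule absolutely_integrable_bounded_measurable_product_real)
  show "k \<in> borel_measurable (lebesgue_on {a..b})"
    using k by (intro continuous_imp_measurable_on_sets_lebesgue) auto
  show "bounded (k ` {a..b})"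
    using k by (intro compact_imp_bounded compact_continuous_image) auto
  show "(\<lambda>x. \<bar>v x\<bar>) absolutely_integrable_on {a..b}"
    using v by (rule set_integrable_abs)
qed auto

text \<open>The substitution inequality needs neither monotonicity nor differentiability of \<open>u\<close>, only that
  \<open>u\<close> is an indefinite integral of \<open>v\<close>: it holds up to \<open>\<epsilon>\<close> on short intervals and is additive.\<close>

lemma integral_le_integral_substitution:
  fixes u v h :: "real \<Rightarrow> real"
  assumes ab: "a \<le> b" and u: "continuous_on {a..b} u"
    and inc: "\<And>s t. a \<le> s \<Longrightarrow> s \<le> t \<Longrightarrow> t \<le> b \<Longrightarrow> u t - u s = integral {s..t} v"
    and v: "v absolutely_integrable_on {a..b}"
    and pos: "\<And>x. x \<in> {a..b} \<Longrightarrow> u x > 0"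
    and h: "continuous_on {0<..} h" and h0: "\<And>t. t > 0 \<Longrightarrow> h t \<ge> 0"
    and le: "u a \<le> u b"
  shows "integral {u a..u b} h \<le> integral {a..b} (\<lambda>x. h (u x) * \<bar>v x\<bar>)"
proof -
  \<comment> \<open>The minimum of \<open>u\<close> is a positive base point for the primitive
    \<open>H\<close> of \<open>h\<close>: all values of \<open>u\<close> stay in a region where
    \<open>h\<close> is continuous.\<close>
  obtain xm where xm: "xm \<in> {a..b}" "\<And>x. x \<in> {a..b} \<Longrightarrow> u xm \<le> u x"
    using continuous_attains_inf[of "{a..b}" u] ab u by auto
  define c where "c = u xm"
  have c: "c > 0" "\<And>x. x \<in> {a..b} \<Longrightarrow> c \<le> u x"
    using xm pos by (auto simp: c_def)
  have hint: "h integrable_on {s..t}" if "c \<le> s" for s t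
    using that c(1) by (intro integrable_continuous_real continuous_on_subset[OF h]) auto
  define H where "H s = integral {c..s} h" for s
  have Hd: "H t - H s = integral {s..t} h" if "c \<le> s" "s \<le> t" for s t
    using Henstock_Kurzweil_Integration.integral_combine[of c s t h] that hint[of c t] by (simp add: H_def)
  \<comment> \<open>Stated for either order of \<open>s\<close> and \<open>t\<close>, because
    \<open>u\<close> may decrease on a short interval.\<close>
  have HK: "\<bar>H t - H s\<bar> \<le> K * \<bar>t - s\<bar>"
    if st: "c \<le> s" "c \<le> t" and K: "\<And>r. r \<in> closed_segment s t \<Longrightarrow> h r \<le> K" for s t K
  proof -
    have *: "\<bar>H t - H s\<bar> \<le> K * (t - s)"
      if st: "c \<le> s" "s \<le> t" and K: "\<And>r. r \<in> {s..t} \<Longrightarrow> h r \<le> K" for s t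
    proof -
      have "integral {s..t} h \<le> integral {s..t} (\<lambda>_. K)"
        using hint[OF st(1)] K by (intro integral_le) auto
      moreover have "integral {s..t} h \<ge> 0"
        using hint[OF st(1)] c st h0 by (intro Henstock_Kurzweil_Integration.integral_nonneg) auto
      ultimately show ?thesis using Hd[OF st] st by (simp add: mult.commute)
    qed
    show ?thesis
      using *[of s t] *[of t s] st K by (cases "s \<le> t") (auto simp: closed_segment_eq_real_ivl abs_minus_commute)
  qed
  have hu: "continuous_on {a..b} (\<lambda>x. h (u x))"
    by (rule continuous_on_compose2[OF h u]) (use pos in auto)
  have abs_int: "(\<lambda>x. (h (u x) + \<epsilon>) * \<bar>v x\<bar>) absolutely_integrable_on {a..b}" for \<epsilon>
    by (intro absolutely_integrable_continuous_times continuous_intros hu v)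
  have int: "(\<lambda>x. (h (u x) + \<epsilon>) * \<bar>v x\<bar>) integrable_on {s..t}" if "a \<le> s" "t \<le> b" for s t \<epsilon>
    using absolutely_integrable_on_subinterval[OF abs_int, of s t] that
    by (simp add: absolutely_integrable_on_def)
  have vint: "v integrable_on {s..t}" "(\<lambda>x. \<bar>v x\<bar>) integrable_on {s..t}" if "a \<le> s" "t \<le> b" for s t
    using absolutely_integrable_on_subinterval[OF v, of s t] that
    by (simp_all add: absolutely_integrable_on_def)
  have main: "\<bar>H (u b) - H (u a)\<bar> \<le> integral {a..b} (\<lambda>x. (h (u x) + \<epsilon>) * \<bar>v x\<bar>)" if \<epsilon>: "\<epsilon> > 0" for \<epsilon>
  proof -
    define P where "P s t \<longleftrightarrow> (a \<le> s \<and> s \<le> t \<and> t \<le> b \<longrightarrow>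
      \<bar>H (u t) - H (u s)\<bar> \<le> integral {s..t} (\<lambda>x. (h (u x) + \<epsilon>) * \<bar>v x\<bar>))" for s t
    \<comment> \<open>Bisection: the estimate is additive over adjacent intervals, so it is enough
      to have it on all short intervals around each point.\<close>
    have "P a b"
      using ab
    proof (induction rule: Bolzano)
      case (trans r s t)
      show ?case
        unfolding P_def
      proof
        assume st: "a \<le> r \<and> r \<le> t \<and> t \<le> b"
        then have "\<bar>H (u s) - H (u r)\<bar> \<le> integral {r..s} (\<lambda>x. (h (u x) + \<epsilon>) * \<bar>v x\<bar>)"
          "\<bar>H (u t) - H (u s)\<bar> \<le> integral {s..t} (\<lambda>x. (h (u x) + \<epsilon>) * \<bar>v x\<bar>)"
          using trans unfolding P_def by auto
        moreover have "integral {r..s} (\<lambda>x. (h (u x) + \<epsilon>) * \<bar>v x\<bar>) +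
            integral {s..t} (\<lambda>x. (h (u x) + \<epsilon>) * \<bar>v x\<bar>) = integral {r..t} (\<lambda>x. (h (u x) + \<epsilon>) * \<bar>v x\<bar>)"
          using trans st by (intro Henstock_Kurzweil_Integration.integral_combine int) auto
        ultimately show "\<bar>H (u t) - H (u r)\<bar> \<le> integral {r..t} (\<lambda>x. (h (u x) + \<epsilon>) * \<bar>v x\<bar>)"
          by linarith
      qed
    next
      case (local x)
      have x: "x \<in> {a..b}" using local by simp
      obtain d where d: "d > 0" "\<And>x'. x' \<in> {a..b} \<Longrightarrow> dist x' x < d \<Longrightarrow> dist (h (u x')) (h (u x)) < \<epsilon> / 2"
        using hu[unfolded continuous_on_iff, rule_format, OF x, of "\<epsilon> / 2"] \<epsilon> by auto
      show ?case
      proof (intro exI conjI allI impI)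
        show "d > 0" by fact
        fix s t assume st: "s \<le> x \<and> x \<le> t \<and> t - s < d"
        show "P s t"
          unfolding P_def
        proof
          assume st': "a \<le> s \<and> s \<le> t \<and> t \<le> b"
          \<comment> \<open>With h(u) varying by less than \<epsilon>/2 near \<open>x\<close>, this
            constant lies between h(u) and h(u) + \<epsilon> on the whole short interval.\<close>
          define K where "K = h (u x) + \<epsilon> / 2"
          have near: "h (u x') \<le> K" "K \<le> h (u x') + \<epsilon>" if "x' \<in> {s..t}" for x'
          proof -
            have "dist (h (u x')) (h (u x)) < \<epsilon> / 2"
              using that st st' by (intro d(2)) (auto simp: dist_real_def)
            then show "h (u x') \<le> K" "K \<le> h (u x') + \<epsilon>"
              unfolding K_def dist_real_def by linarith+
          qed
          have K0: "K \<ge> 0" using h0[OF pos[OF x]] \<epsilon> by (simp add: K_def)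
          \<comment> \<open>By the intermediate value theorem each such \<open>r\<close> is a value
            of \<open>u\<close> on [s,t], where h(u) is under control.\<close>
          have "h r \<le> K" if r: "r \<in> closed_segment (u s) (u t)" for r
          proof -
            have "continuous_on (closed_segment s t) u"
              using st' by (intro continuous_on_subset[OF u]) (auto simp: closed_segment_eq_real_ivl)
            then obtain x' where "x' \<in> closed_segment s t" "u x' = r"
              using IVT'_closed_segment_real[of r u s t] r by blast
            then show ?thesis using near[of x'] st' by (auto simp: closed_segment_eq_real_ivl)
          qed
          then have "\<bar>H (u t) - H (u s)\<bar> \<le> K * \<bar>u t - u s\<bar>"
            using c st' by (intro HK) auto
          also have "\<dots> = K * \<bar>integral {s..t} v\<bar>"
            using inc[of s t] st' by simp
          also have "\<dots> \<le> K * integral {s..t} (\<lambda>x. \<bar>v x\<bar>)"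
            using integral_norm_bound_integral[OF vint[of s t]] st' K0 by (intro mult_left_mono) auto
          also have "\<dots> = integral {s..t} (\<lambda>x. K * \<bar>v x\<bar>)"
            by simp
          also have "\<dots> \<le> integral {s..t} (\<lambda>x. (h (u x) + \<epsilon>) * \<bar>v x\<bar>)"
            using st' near by (intro integral_le int integrable_on_mult_right vint mult_right_mono) auto
          finally show "\<bar>H (u t) - H (u s)\<bar> \<le> integral {s..t} (\<lambda>x. (h (u x) + \<epsilon>) * \<bar>v x\<bar>)" .
        qed
      qed
    qed
    then show ?thesis using ab by (simp add: P_def)
  qed
  define I where "I = integral {a..b} (\<lambda>x. h (u x) * \<bar>v x\<bar>)"
  define J where "J = integral {a..b} (\<lambda>x. \<bar>v x\<bar>)"
  have J: "J \<ge> 0"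
    unfolding J_def using vint[of a b] by (intro Henstock_Kurzweil_Integration.integral_nonneg) auto
  have "integral {u a..u b} h \<le> I"
  proof (rule field_le_epsilon)
    fix e :: real assume e: "e > 0"
    \<comment> \<open>J + 1 rather than J, since J may be 0.\<close>
    define \<epsilon> where "\<epsilon> = e / (J + 1)"
    have \<epsilon>: "\<epsilon> > 0" "\<epsilon> * J \<le> e" using e J by (auto simp: \<epsilon>_def field_simps)
    have "integral {u a..u b} h \<le> integral {a..b} (\<lambda>x. (h (u x) + \<epsilon>) * \<bar>v x\<bar>)"
      using main[OF \<epsilon>(1)] Hd[OF c(2) le] ab by simp
    also have "\<dots> = integral {a..b} (\<lambda>x. h (u x) * \<bar>v x\<bar> + \<epsilon> * \<bar>v x\<bar>)"
      by (simp add: distrib_right)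
    also have "\<dots> = I + \<epsilon> * J"
      using int[of a b 0] vint[of a b] unfolding I_def J_def
      by (subst Henstock_Kurzweil_Integration.integral_add) (simp_all add: integrable_on_mult_right)
    finally show "integral {u a..u b} h \<le> I + e" using \<epsilon>(2) by linarith
  qed
  then show ?thesis by (simp add: I_def)
qed

text \<open>Monotone convergence along the cut-offs \<delta>/(n+1). The cut-off also settles
  measurability: nothing is known about \<open>h\<close> at 0 and below.\<close>

lemma set_nn_integral_le_of_truncations:
  fixes h :: "real \<Rightarrow> real"
  assumes \<delta>: "\<delta> > 0" and h: "continuous_on {0<..} h" and h0: "\<And>t. t > 0 \<Longrightarrow> h t \<ge> 0"
    and le: "\<And>\<epsilon>. 0 < \<epsilon> \<Longrightarrow> \<epsilon> \<le> \<delta> \<Longrightarrow> integral {\<epsilon>..\<delta>} h \<le> C"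
  shows "(\<integral>\<^sup>+t\<in>{0<..<\<delta>}. ennreal (h t) \<partial>lebesgue) \<le> ennreal C"
proof -
  define \<epsilon> where "\<epsilon> n = \<delta> / real (Suc n)" for n
  have \<epsilon>: "0 < \<epsilon> n" "\<epsilon> n \<le> \<delta>" for n
    using \<delta> by (auto simp: \<epsilon>_def field_simps)
  define F where "F n t = ennreal (h t) * indicator {\<epsilon> n..\<delta>} t" for n t
  have F: "F n = (\<lambda>t. ennreal (indicator {\<epsilon> n..\<delta>} t *\<^sub>R h t))" for n
    by (auto simp: F_def indicator_def)
  have meas: "F n \<in> borel_measurable lborel" for n
  proof -
    have "(\<lambda>t. indicator {\<epsilon> n..\<delta>} t *\<^sub>R h t) \<in> borel_measurable borel"
      using \<epsilon>(1)[of n]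
      by (intro borel_measurable_continuous_on_indicator continuous_on_subset[OF h]) auto
    then show ?thesis unfolding F by simp
  qed
  have "(\<integral>\<^sup>+t\<in>{0<..<\<delta>}. ennreal (h t) \<partial>lebesgue) = (\<integral>\<^sup>+t\<in>{0<..<\<delta>}. ennreal (h t) \<partial>lborel)"
    by (rule nn_integral_completion)
  also have "\<dots> \<le> (\<integral>\<^sup>+t. (SUP n. F n t) \<partial>lborel)"
  proof (rule nn_integral_mono)
    fix t
    show "ennreal (h t) * indicator {0<..<\<delta>} t \<le> (SUP n. F n t)"
    proof (cases "t \<in> {0<..<\<delta>}")
      case True
      then obtain n where "inverse (real (Suc n)) < t / \<delta>"
        using reals_Archimedean[of "t / \<delta>"] \<delta> by auto
      then have "\<epsilon> n \<le> t" using \<delta> by (simp add: \<epsilon>_def field_simps)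
      then show ?thesis using True by (intro SUP_upper2[of n]) (auto simp: F_def)
    qed auto
  qed
  also have "\<dots> = (SUP n. integral\<^sup>N lborel (F n))"
  proof (rule nn_integral_monotone_convergence_SUP[OF _ meas])
    show "incseq F"
    proof (intro incseq_SucI le_funI)
      fix n t
      have "\<epsilon> (Suc n) \<le> \<epsilon> n" unfolding \<epsilon>_def using \<delta> by (intro divide_left_mono) auto
      then show "F n t \<le> F (Suc n) t" by (auto simp: F_def indicator_def)
    qed
  qed
  also have "\<dots> \<le> ennreal C"
  proof (rule SUP_least)
    fix n
    have "h integrable_on {\<epsilon> n..\<delta>}"
      using \<epsilon>(1)[of n] by (intro integrable_continuous_real continuous_on_subset[OF h]) auto
    then have "integral\<^sup>N lborel (F n) = ennreal (integral {\<epsilon> n..\<delta>} h)"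
      unfolding F_def using \<epsilon>(1)[of n] h0
      by (intro nn_integral_has_integral_lebesgue') (auto simp: has_integral_integral)
    then show "integral\<^sup>N lborel (F n) \<le> ennreal C"
      using le[OF \<epsilon>] by (simp add: ennreal_leI)
  qed
  finally show ?thesis .
qed

text \<open>As \<open>G\<close> is nonnegative, the domain can be enlarged to (0,L); the resulting
  bound is the same for all subintervals.\<close>

lemma integral_Icc_le_LINT:
  fixes f G :: "real \<Rightarrow> real"
  assumes f: "f absolutely_integrable_on {a..b}" and ab: "0 < a" "b < L"
    and G: "integrable (lebesgue_on {0<..<L}) G" and G0: "\<And>x. G x \<ge> 0"
    and le: "AE x in lebesgue_on {0<..<L}. f x \<le> G x"
  shows "integral {a..b} f \<le> (LINT x|lebesgue_on {0<..<L}. G x)"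
proof -
  have "integral {a..b} f = (LINT x|lebesgue. indicator {a..b} x *\<^sub>R f x)"
    using set_lebesgue_integral_eq_integral(2)[OF f] by (simp add: set_lebesgue_integral_def)
  also have "\<dots> \<le> (LINT x|lebesgue. indicator {0<..<L} x *\<^sub>R G x)"
  proof (rule integral_mono_AE)
    show "integrable lebesgue (\<lambda>x. indicator {a..b} x *\<^sub>R f x)"
      using f by (simp add: set_integrable_def)
    show "integrable lebesgue (\<lambda>x. indicator {0<..<L} x *\<^sub>R G x)"
      using G by (simp add: integrable_restrict_space)
    have "AE x in lebesgue. x \<in> {0<..<L} \<longrightarrow> f x \<le> G x"
      using le by (simp add: AE_restrict_space_iff)
    then show "AE x in lebesgue. indicator {a..b} x *\<^sub>R f x \<le> indicator {0<..<L} x *\<^sub>R G x"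
      by eventually_elim (use ab G0 in \<open>auto simp: indicator_def\<close>)
  qed
  also have "\<dots> = (LINT x|lebesgue_on {0<..<L}. G x)"
    by (simp add: integral_restrict_space)
  finally show ?thesis .
qed

text \<open>Each level \<epsilon> in (0, u x0] is attained at some y beyond the last zero, and
  substitution on [y,x0] bounds the integral of \<open>h\<close> over [\<epsilon>, u x0] by the
  integral of \<open>G\<close>, whatever \<epsilon> is. Keeping \<open>h\<close> and
  \<open>G\<close> abstract lets the same argument serve for - u.\<close>

lemma set_nn_integral_finite_of_positive_value:
  fixes u v h G :: "real \<Rightarrow> real"
  assumes u: "continuous_on {0..L} u" and u_eq: "\<And>x. x \<in> {0..L} \<Longrightarrow> u x = integral {0..x} v"
    and v: "integrable (lebesgue_on {0<..<L}) v"
    and x0: "0 < x0" "x0 < L" "u x0 > 0"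
    and h: "continuous_on {0<..} h" and h0: "\<And>t. t > 0 \<Longrightarrow> h t \<ge> 0"
    and G: "integrable (lebesgue_on {0<..<L}) G" and G0: "\<And>x. G x \<ge> 0"
    and le: "AE x in lebesgue_on {0<..<L}. h (u x) * \<bar>v x\<bar> \<le> G x"
  shows "(\<integral>\<^sup>+t\<in>{0<..<u x0}. ennreal (h t) \<partial>lebesgue) < \<infinity>"
proof -
  define C where "C = (LINT x|lebesgue_on {0<..<L}. G x)"
  define Z where "Z = {x \<in> {0..x0}. u x = 0}"
  have cont: "continuous_on {0..x0} u"
    using x0 by (intro continuous_on_subset[OF u]) auto
  have "u 0 = 0" using u_eq[of 0] x0 by simp
  then have "0 \<in> Z" using x0 by (simp add: Z_def)
  have "closed Z"
    unfolding Z_def by (rule continuous_closed_preimage_constant[OF cont]) simp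
  define y0 where "y0 = Sup Z"
  have bdd: "bdd_above Z" by (auto simp: Z_def)
  have y0: "y0 \<in> Z"
    unfolding y0_def using \<open>closed Z\<close> \<open>0 \<in> Z\<close> bdd by (intro closed_contains_Sup) auto
  then have y0': "0 \<le> y0" "y0 < x0" "u y0 = 0"
    using x0(3) by (auto simp: Z_def less_le)
  \<comment> \<open>Otherwise the intermediate value theorem would give a zero in [x,x0], beyond the
    last one.\<close>
  have pos: "u x > 0" if x: "y0 < x" "x \<le> x0" for x
  proof (rule ccontr)
    assume "\<not> u x > 0"
    moreover have "continuous_on {x..x0} u"
      using that y0' by (intro continuous_on_subset[OF cont]) auto
    ultimately obtain z where "x \<le> z" "z \<le> x0" "u z = 0"
      using IVT'[of u x 0 x0] x x0 by auto
    then have "z \<in> Z" using x y0' by (simp add: Z_def)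
    then have "z \<le> y0" unfolding y0_def by (rule cSup_upper[OF _ bdd])
    then show False using \<open>x \<le> z\<close> that by simp
  qed
  have vabs: "v absolutely_integrable_on {0..L}"
    by (rule integrable_imp_absolutely_integrable_Icc[OF v])
  have "integral {\<epsilon>..u x0} h \<le> C" if \<epsilon>: "0 < \<epsilon>" "\<epsilon> \<le> u x0" for \<epsilon>
  proof -
    obtain y where y: "y0 \<le> y" "y \<le> x0" "u y = \<epsilon>"
      using IVT'[of u y0 \<epsilon> x0] \<epsilon> y0' continuous_on_subset[OF cont, of "{y0..x0}"] by auto
    have "y \<noteq> y0" using y y0' \<epsilon> by auto
    with y have "y0 < y" by simp
    have vy: "v absolutely_integrable_on {y..x0}"
      using x0 y0' y by (intro absolutely_integrable_on_subinterval[OF vabs]) auto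
    have cy: "continuous_on {y..x0} u"
      using y0' y by (intro continuous_on_subset[OF cont]) auto
    have posy: "u x > 0" if "x \<in> {y..x0}" for x
      using that \<open>y0 < y\<close> by (intro pos) auto
    have "integral {u y..u x0} h \<le> integral {y..x0} (\<lambda>x. h (u x) * \<bar>v x\<bar>)"
    proof (rule integral_le_integral_substitution[OF y(2) cy _ vy posy h h0])
      fix s t assume st: "y \<le> s" "s \<le> t" "t \<le> x0"
      have "v absolutely_integrable_on {0..t}"
        using st x0 by (intro absolutely_integrable_on_subinterval[OF vabs]) auto
      then have "integral {0..s} v + integral {s..t} v = integral {0..t} v"
        using st y y0' by (intro Henstock_Kurzweil_Integration.integral_combine)
          (auto simp: absolutely_integrable_on_def)
      then show "u t - u s = integral {s..t} v"
        using u_eq[of s] u_eq[of t] st y y0' x0 by simp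
    qed (use y \<epsilon> in auto)
    also have "\<dots> \<le> C"
      unfolding C_def
    proof (rule integral_Icc_le_LINT[OF _ _ _ G G0 le])
      show "(\<lambda>x. h (u x) * \<bar>v x\<bar>) absolutely_integrable_on {y..x0}"
        by (rule absolutely_integrable_continuous_times[OF continuous_on_compose2[OF h cy] vy])
           (use posy in auto)
    qed (use y0' x0 \<open>y0 < y\<close> in auto)
    finally show ?thesis using y by simp
  qed
  then have "(\<integral>\<^sup>+t\<in>{0<..<u x0}. ennreal (h t) \<partial>lebesgue) \<le> ennreal C"
    by (intro set_nn_integral_le_of_truncations x0 h h0)
  then show ?thesis by (auto intro: order_le_less_trans)
qed

subsection \<open>Nonexistence\<close>

lemma integrable_bounded_times:
  fixes a f :: "real \<Rightarrow> real"
  assumes f: "integrable M f" and a: "a \<in> borel_measurable M" and C: "AE x in M. \<bar>a x\<bar> \<le> C"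
  shows "integrable M (\<lambda>x. a x * f x)"
proof (rule Bochner_Integration.integrable_bound[of M "\<lambda>x. C * f x"])
  show "AE x in M. norm (a x * f x) \<le> norm (C * f x)"
    using C by eventually_elim (auto simp: abs_mult intro!: mult_right_mono)
qed (use f a in auto)

text \<open>The mixed term A^(m-1) B is at most the m-th power of the larger of the two numbers, an
  elementary form of Young's inequality.\<close>

lemma powr_times_sum_le:
  fixes A B m :: real
  assumes "A \<ge> 0" "B \<ge> 0" "m > 1"
  shows "A powr (m - 1) * (A + B) \<le> 2 * A powr m + B powr m"
proof -
  have eq: "x powr (m - 1) * x = x powr m" if "x \<ge> 0" for x :: real
    using that assms by (cases "x = 0") (simp_all add: powr_diff)
  have "A powr (m - 1) * B \<le> A powr m + B powr m"
  proof (cases "A \<le> B")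
    case True
    then have "A powr (m - 1) * B \<le> B powr (m - 1) * B"
      using assms by (intro mult_right_mono powr_mono2) auto
    then show ?thesis using eq[of B] assms by (simp add: add_increasing)
  next
    case False
    then have "A powr (m - 1) * B \<le> A powr (m - 1) * A"
      using assms by (intro mult_left_mono) auto
    then show ?thesis using eq[of A] assms by (simp add: add_increasing2)
  qed
  then show ?thesis using eq[of A] assms by (simp add: distrib_left)
qed

lemma weak_solution_flux:
  assumes L: "L > 0" and m: "m > 1" and a: "a \<in> Linf L" and g: "g \<in> Lp L m"
    and sol: "weak_solution L m a g \<phi> u"
  obtains Du c where "W1p L m u Du"
    "AE x in lebesgue_on {0<..<L}. a x * Du x = real_of_ereal (\<phi> (u x)) + g x + c"
proof -
  let ?M = "lebesgue_on {0<..<L}"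
  define \<Phi> where "\<Phi> x = real_of_ereal (\<phi> (u x))" for x
  have \<Phi>: "\<Phi> \<in> Lp L m"
    using sol unfolding weak_solution_def Lp_ereal_def \<Phi>_def[abs_def] by blast
  obtain Du where Du: "W1p L m u Du"
    and eq: "\<And>z Dz. z \<in> W1p0 L (m / (m - 1)) \<Longrightarrow> W1p L (m / (m - 1)) z Dz \<Longrightarrow>
      (LINT x|?M. a x * Du x * Dz x) = (LINT x|?M. \<Phi> x * Dz x) + (LINT x|?M. g x * Dz x)"
    using sol unfolding weak_solution_def \<Phi>_def[abs_def] by blast
  have "Du \<in> Lp L m" using Du by (simp add: W1p_def)
  then have "integrable ?M Du" using m by (intro Lp_integrable) auto
  moreover obtain C where "AE x in ?M. \<bar>a x\<bar> \<le> C" and aM: "a \<in> borel_measurable ?M"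
    using a by (auto simp: Linf_def)
  ultimately have aDu: "integrable ?M (\<lambda>x. a x * Du x)"
    by (intro integrable_bounded_times)
  have \<Phi>I: "integrable ?M \<Phi>" and gI: "integrable ?M g"
    using \<Phi> g m by (auto intro: Lp_integrable)
  define w where "w x = a x * Du x - \<Phi> x - g x" for x
  have w: "integrable ?M w"
    unfolding w_def using aDu \<Phi>I gI by simp
  have "(LINT x|?M. w x * deriv \<psi> x) = 0" if \<psi>: "\<psi> \<in> test_functions L" for \<psi>
  proof -
    have "\<psi> \<in> W1p0 L (m / (m - 1))" "W1p L (m / (m - 1)) \<psi> (deriv \<psi>)"
      using \<psi> L m by (auto intro!: test_function_W1p0 test_function_W1p)
    note eq = eq[OF this]
    note int = integrable_mult_test_function[OF _ test_function_deriv[OF \<psi>]]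
    have "(LINT x|?M. w x * deriv \<psi> x) =
      (LINT x|?M. a x * Du x * deriv \<psi> x - \<Phi> x * deriv \<psi> x - g x * deriv \<psi> x)"
      by (rule Bochner_Integration.integral_cong) (simp_all add: w_def left_diff_distrib)
    also have "\<dots> = (LINT x|?M. a x * Du x * deriv \<psi> x) - (LINT x|?M. \<Phi> x * deriv \<psi> x)
        - (LINT x|?M. g x * deriv \<psi> x)"
      using int[OF aDu] int[OF \<Phi>I] int[OF gI] by simp
    finally show ?thesis using eq by simp
  qed
  then obtain c where "AE x in ?M. w x = c"
    using du_Bois_Reymond[OF L w] by blast
  then have "AE x in ?M. a x * Du x = \<Phi> x + g x + c"
    by eventually_elim (simp add: w_def)
  with Du show thesis by (intro that) (simp_all add: \<Phi>_def)
qed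

lemma AE_Ioo_obtain:
  assumes "AE x in lebesgue_on {0<..<L}. P x" and L: "L > (0::real)"
  obtains x where "0 < x" "x < L" "P x"
proof -
  have "\<exists>x\<in>{0<..<L}. P x"
  proof (rule ccontr)
    assume no: "\<not> (\<exists>x\<in>{0<..<L}. P x)"
    have "AE x in lebesgue. x \<notin> {0<..<L}"
      using assms(1) no by (auto simp: AE_restrict_space_iff elim: eventually_mono)
    then have "emeasure lebesgue {0<..<L} = 0"
      by (subst (asm) AE_iff_null_sets[symmetric]) auto
    then show False using L by simp
  qed
  with that show thesis by auto
qed

text \<open>Moves the divergence at 0 from the left to the right side. Continuity on the negative
  axis supplies the measurability that the change of variables requires.\<close>

lemma set_nn_integral_reflect:
  fixes h :: "real \<Rightarrow> real"
  assumes h: "continuous_on {..<0} h"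
  shows "(\<integral>\<^sup>+t\<in>{-\<delta><..<0}. ennreal (h t) \<partial>lebesgue) = (\<integral>\<^sup>+t\<in>{0<..<\<delta>}. ennreal (h (- t)) \<partial>lebesgue)"
proof -
  let ?f = "\<lambda>t. ennreal (h t) * indicator {-\<delta><..<0} t"
  have "(\<lambda>t. indicator {-\<delta><..<0} t *\<^sub>R h t) \<in> borel_measurable borel"
    by (intro borel_measurable_continuous_on_indicator continuous_on_subset[OF h]) auto
  then have "(\<lambda>t. ennreal (indicator {-\<delta><..<0} t *\<^sub>R h t)) \<in> borel_measurable lborel"
    by simp
  moreover have "(\<lambda>t. ennreal (indicator {-\<delta><..<0} t *\<^sub>R h t)) = ?f"
    by (auto simp: indicator_def)
  ultimately have "?f \<in> borel_measurable lebesgue"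
    by (simp add: measurable_completion)
  then have "(\<integral>\<^sup>+t. ?f t \<partial>lebesgue) = (\<integral>\<^sup>+t. ?f (0 + (-1) * t) \<partial>lebesgue)"
    by (subst nn_integral_real_affine_lebesgue[where t = 0 and c = "-1"]) auto
  also have "\<dots> = (\<integral>\<^sup>+t\<in>{0<..<\<delta>}. ennreal (h (- t)) \<partial>lebesgue)"
    by (intro nn_integral_cong) (auto simp: indicator_def)
  finally show ?thesis .
qed

theorem theorem3p1:
  fixes L m :: real and a g :: "real \<Rightarrow> real" and \<phi> :: "real \<Rightarrow> ereal"
  assumes "L > 0" and "m > 1"
    and "a \<in> Linf L"
    and "\<exists>\<alpha> \<beta>. 0 < \<alpha> \<and> \<alpha> < \<beta> \<and> (AE x in lebesgue_on {0<..<L}. \<alpha> \<le> a x \<and> a x \<le> \<beta>)"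
    and "g \<in> Lp L m"
    and "continuous_on UNIV \<phi>"
    and "\<And>s. \<phi> s \<noteq> -\<infinity>"
    and "\<And>s. s \<noteq> 0 \<Longrightarrow> \<phi> s < \<infinity>"
    and "\<phi> 0 = \<infinity>"
    and "\<And>\<delta>. \<delta> > 0 \<Longrightarrow>
      (\<integral>\<^sup>+t\<in>{0<..<\<delta>}. ennreal (\<bar>real_of_ereal (\<phi> t)\<bar> powr (m - 1)) \<partial>lebesgue) = \<infinity>"
    and "\<And>\<delta>. \<delta> > 0 \<Longrightarrow>
      (\<integral>\<^sup>+t\<in>{-\<delta><..<0}. ennreal (\<bar>real_of_ereal (\<phi> t)\<bar> powr (m - 1)) \<partial>lebesgue) = \<infinity>"
  shows "\<not> (\<exists>u. weak_solution L m a g \<phi> u)"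
proof
  note L = assms(1) and m = assms(2)
  let ?M = "lebesgue_on {0<..<L}"
  assume "\<exists>u. weak_solution L m a g \<phi> u"
  then obtain u where sol: "weak_solution L m a g \<phi> u" by blast
  obtain Du c where Du: "W1p L m u Du"
    and flux: "AE x in ?M. a x * Du x = real_of_ereal (\<phi> (u x)) + g x + c"
    using weak_solution_flux[OF L m assms(3,5) sol] by blast
  obtain \<alpha> where \<alpha>: "\<alpha> > 0" "AE x in ?M. \<alpha> \<le> a x"
    using assms(4) by (auto elim: eventually_mono)
  \<comment> \<open>At t = 0 the infinite value is read as 0, so h 0 = 0 while \<open>h\<close>
    blows up nearby; continuity is therefore claimed only on sets that avoid 0.\<close>
  define h where "h t = \<bar>real_of_ereal (\<phi> t)\<bar> powr (m - 1)" for t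
  define \<Phi> where "\<Phi> x = real_of_ereal (\<phi> (u x))" for x
  have \<Phi>: "integrable ?M (\<lambda>x. \<bar>\<Phi> x\<bar> powr m)"
    and fin: "AE x in ?M. \<bar>\<phi> (u x)\<bar> \<noteq> \<infinity>"
    and u: "u \<in> W1p0 L m"
    using sol by (auto simp: weak_solution_def Lp_ereal_def Lp_def \<Phi>_def)
  have "Du \<in> Lp L m" using Du by (simp add: W1p_def)
  then have DuI: "integrable ?M Du" using m by (intro Lp_integrable) auto
  have cont: "continuous_on {0..L} u" using u by (simp add: W1p0_def)
  have u_eq: "u x = integral {0..x} Du" if "x \<in> {0..L}" for x
    using W1p0_eq_integral[OF u Du _ L that] m by simp
  have h_cont: "continuous_on A h" if "0 \<notin> A" for A
  proof -
    have "continuous_on A (real_of_ereal \<circ> \<phi>)"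
    proof (subst continuous_on_iff_real[symmetric])
      show "\<bar>\<phi> s\<bar> \<noteq> \<infinity>" if "s \<in> A" for s
        using that \<open>0 \<notin> A\<close> assms(7)[of s] assms(8)[of s] by (cases "\<phi> s") auto
    qed (rule continuous_on_subset[OF assms(6)], simp)
    then show ?thesis
      unfolding h_def using m by (intro continuous_on_powr' continuous_intros) (auto simp: o_def real_of_ereal_pos)
  qed
  \<comment> \<open>The bound of \<open>powr_times_sum_le\<close> with A = |\<Phi>| and B = |g| +
    |c|, with B^m split by \<open>powr_add_le\<close>; the division by \<alpha> comes from |a| \<ge>
    \<alpha>.\<close>
  define G where "G x = (2 * \<bar>\<Phi> x\<bar> powr m + 2 powr m * (\<bar>g x\<bar> powr m + \<bar>c\<bar> powr m)) / \<alpha>" for x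
  have G: "integrable ?M G"
    unfolding G_def using \<Phi> assms(5)
    by (simp add: Lp_def finite_measure.integrable_const[OF finite_measure_Ioo])
  have G0: "G x \<ge> 0" for x
    using \<alpha> by (simp add: G_def)
  have le: "AE x in ?M. h (u x) * \<bar>Du x\<bar> \<le> G x"
    using flux \<alpha>(2)
  proof eventually_elim
    case (elim x)
    define B where "B = \<bar>g x\<bar> + \<bar>c\<bar>"
    have "\<alpha> * \<bar>Du x\<bar> \<le> \<bar>a x\<bar> * \<bar>Du x\<bar>"
      using elim(2) by (intro mult_right_mono) auto
    also have "\<dots> = \<bar>\<Phi> x + g x + c\<bar>"
      using elim(1) by (simp add: \<Phi>_def flip: abs_mult)
    also have "\<dots> \<le> \<bar>\<Phi> x\<bar> + B" unfolding B_def by linarith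
    finally have "h (u x) * (\<alpha> * \<bar>Du x\<bar>) \<le> \<bar>\<Phi> x\<bar> powr (m - 1) * (\<bar>\<Phi> x\<bar> + B)"
      unfolding h_def \<Phi>_def by (intro mult_left_mono) auto
    also have "\<dots> \<le> 2 * \<bar>\<Phi> x\<bar> powr m + B powr m"
      using m by (intro powr_times_sum_le) (auto simp: B_def)
    also have "\<dots> \<le> 2 * \<bar>\<Phi> x\<bar> powr m + 2 powr m * (\<bar>g x\<bar> powr m + \<bar>c\<bar> powr m)"
      using powr_add_le[of "\<bar>g x\<bar>" "\<bar>c\<bar>" m] m by (simp add: B_def)
    finally show ?case
      using \<alpha>(1) by (simp add: G_def pos_le_divide_eq mult_ac)
  qed
  \<comment> \<open>This rests on the a.e. finiteness in \<open>Lp_ereal\<close>; integrability of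
    \<Phi> could not exclude zeros of \<open>u\<close>, as \<Phi> takes the default value 0
    there.\<close>
  have "AE x in ?M. u x \<noteq> 0"
    using fin by eventually_elim (auto simp: assms(9))
  then obtain x0 where x0: "0 < x0" "x0 < L" "u x0 \<noteq> 0"
    using AE_Ioo_obtain[OF _ L] by blast
  show False
  proof (cases "u x0 > 0")
    case True
    have "(\<integral>\<^sup>+t\<in>{0<..<u x0}. ennreal (h t) \<partial>lebesgue) < \<infinity>"
    proof (rule set_nn_integral_finite_of_positive_value[OF cont u_eq DuI x0(1,2) True _ _ G G0 le])
      show "continuous_on {0<..} h" by (rule h_cont) simp
    qed (simp_all add: h_def)
    then show False using assms(10)[OF True] by (simp add: h_def)
  next
    case False
    with x0 have neg: "- u x0 > 0" by simp
    \<comment> \<open>The pair - u and h(- t) has the same composition h(u) and the same |u'|, so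
      the majorant \<open>G\<close> is unchanged.\<close>
    have "(\<integral>\<^sup>+t\<in>{0<..<- u x0}. ennreal (h (- t)) \<partial>lebesgue) < \<infinity>"
    proof (rule set_nn_integral_finite_of_positive_value
        [where u = "\<lambda>x. - u x" and v = "\<lambda>x. - Du x" and h = "\<lambda>t. h (- t)", OF _ _ _ x0(1,2) neg _ _ G G0])
      show "continuous_on {0<..} (\<lambda>t. h (- t))"
        by (rule continuous_on_compose2[OF h_cont[of "{..<0}"]]) (auto intro: continuous_intros)
    qed (use cont DuI le u_eq in \<open>auto simp: h_def intro!: continuous_on_minus\<close>)
    also have "(\<integral>\<^sup>+t\<in>{0<..<- u x0}. ennreal (h (- t)) \<partial>lebesgue) =
        (\<integral>\<^sup>+t\<in>{-(- u x0)<..<0}. ennreal (h t) \<partial>lebesgue)"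
      by (rule set_nn_integral_reflect[symmetric]) (rule h_cont, simp)
    finally show False using assms(11)[OF neg] by (simp add: h_def)
  qed
qed

end
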